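(* Let $G$ be a connected graph on $n$ vertices with second largest eigenvalue $\lambda_2 \ge 1$, and let $\Delta \ge \Delta(G)$. Suppose that for some integer $r \ge 1$ and some real $B \ge 1$, every vertex $v$ of $G$ with degree larger than $\lambda_2 - 1$ satisfies $|B_G^{(r)}(v)| \ge B$. Then, provided $$2^{9}\, r\, \lambda_2^{4r+2} \log B \le \log_{\Delta} n,$$ we have $$m_G(\lambda_2) \le \frac{n}{B-1}.$$
   Context: All graphs are finite and simple; eigenvalues are those of the adjacency matrix, and $m_G(\lambda)$ denotes the multiplicity of $\lambda$ as an eigenvalue of $G$. $\Delta(G)$ is the maximum degree of $G$. $B_G^{(r)}(v)$ is the ball of radius $r$ around $v$: the subgraph of $G$ induced on all vertices at distance at most $r$ from $v$, and $|B_G^{(r)}(v)|$ is its number of vertices. $\log$ is base $2$ and $\log_\Delta n = \log n/\log \Delta$. (When $B=1$ the bound $n/(B-1)$ is interpreted as $+\infty$.) *)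

theory Defs
  imports "HOL-Analysis.Analysis" "Graph_Theory.Graph_Theory"
begin

text \<open>
  A finite simple graph is an instance of the locale \<^locale>\<open>graph\<close> (a finite symmetric digraph
  without loops or parallel arcs), so each undirected edge is a pair of opposite arcs and the degree
  of a vertex is its \<^const>\<open>out_degree\<close>. The adjacency matrix is indexed by the whole vertex type;
  it is the adjacency matrix of \<open>G\<close> when \<open>verts G = UNIV\<close>.
\<close>

definition adjacency_matrix :: "('v::finite, 'e) pre_digraph \<Rightarrow> real^'v^'v" where
  "adjacency_matrix G = (\<chi> u v. if (u, v) \<in> arcs_ends G then 1 else 0)"

definition eigenspace :: "real^'n^'n \<Rightarrow> real \<Rightarrow> (real^'n) set" where
  "eigenspace A \<mu> = {x. A *v x = \<mu> *\<^sub>R x}"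

definition is_eigenvalue :: "real^'n^'n \<Rightarrow> real \<Rightarrow> bool" where
  "is_eigenvalue A \<mu> \<longleftrightarrow> (\<exists>x. x \<noteq> 0 \<and> A *v x = \<mu> *\<^sub>R x)"

text \<open>
  Geometric multiplicity; adjacency matrices are symmetric, so it coincides with the algebraic one.
\<close>

definition eigenvalue_multiplicity :: "real^'n^'n \<Rightarrow> real \<Rightarrow> nat" where
  "eigenvalue_multiplicity A \<mu> = dim (eigenspace A \<mu>)"

text \<open>
  The real eigenvalues in non-increasing order, each repeated according to its multiplicity.
\<close>

definition eigenvalue_list :: "real^'n^'n \<Rightarrow> real list" where
  "eigenvalue_list A =
     rev (concat (map (\<lambda>\<mu>. replicate (eigenvalue_multiplicity A \<mu>) \<mu>)
                      (sorted_list_of_set {\<mu>. is_eigenvalue A \<mu>})))"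

text \<open>
  List positions start at 0. For a one-vertex graph the value is unspecified.
\<close>

definition second_eigenvalue :: "('v::finite, 'e) pre_digraph \<Rightarrow> real" where
  "second_eigenvalue G = eigenvalue_list (adjacency_matrix G) ! 1"

definition graph_multiplicity :: "('v::finite, 'e) pre_digraph \<Rightarrow> real \<Rightarrow> nat" where
  "graph_multiplicity G \<mu> = eigenvalue_multiplicity (adjacency_matrix G) \<mu>"

definition max_degree :: "('v, 'e) pre_digraph \<Rightarrow> nat" where
  "max_degree G = Max (out_degree G ` verts G)"

text \<open>
  The library's shortest-path cost \<open>wf_digraph.\<mu>\<close> with all arc weights equal to 1.
\<close>

definition graph_dist :: "('v, 'e) pre_digraph \<Rightarrow> 'v \<Rightarrow> 'v \<Rightarrow> ereal" where
  "graph_dist G u v = wf_digraph.\<mu> G (\<lambda>_. 1) u v"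

definition graph_ball :: "('v, 'e) pre_digraph \<Rightarrow> nat \<Rightarrow> 'v \<Rightarrow> ('v, 'e) pre_digraph" where
  "graph_ball G r v = induce_subgraph G {u \<in> verts G. graph_dist G v u \<le> ereal (real r)}"

end

theory Submission
  imports Defs
begin

text \<open>
  Write \<open>\<theta>\<close> for the second eigenvalue and put \<open>k = 2r\<close>, \<open>s = kt\<close>. Delete from \<open>G\<close> a set \<open>S = P \<union> X\<close>: here \<open>P\<close> is
  a maximal family of vertices of degree larger than \<open>\<theta> - 1\<close> with disjoint \<open>r\<close>-balls, so \<open>|P| \<le> n / B\<close>,
  and \<open>X\<close> consists of the vertices whose \<open>(s + k)\<close>-ball has spectral radius above \<open>\<theta>\<close>. Any two members
  of \<open>X\<close> are close, since two separated balls of this kind would give two eigenvalues above \<open>\<theta>\<close>; hence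
  \<open>X\<close> is small. Deleting \<open>S\<close> costs at most \<open>|S|\<close> in the multiplicity, and what remains is bounded by the
  closed walks of length \<open>2s\<close> in \<open>G - S\<close>, which are counted by balls of radius \<open>s\<close>.

  In such a ball let \<open>\<mu>\<close> be the spectral radius after deletion and \<open>x\<close> its Perron vector. The vertices at
  distance more than \<open>k\<close> from \<open>P\<close> have degree at most \<open>\<theta> - 1\<close>, so if \<open>\<mu> > \<theta> - 1/2\<close>, then \<open>x\<close> has squared
  mass at least \<open>1 / (2\<theta>)\<close> on the vertices near \<open>P\<close>. Each of these gains a closed walk of length \<open>2k\<close> when
  \<open>S\<close> is put back, whence \<open>\<mu>^(2k) \<le> \<theta>^(2k) - 1 / (2\<theta>)\<close>.
\<close>

section \<open>Symmetric nonnegative matrices\<close>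

lemma sum_squares_le_square_sum:
  fixes f :: "'a \<Rightarrow> real"
  assumes "finite I" and "\<And>i. i \<in> I \<Longrightarrow> 0 \<le> f i"
  shows "(\<Sum>i\<in>I. (f i)\<^sup>2) \<le> (\<Sum>i\<in>I. f i)\<^sup>2"
  using assms
proof (induction I)
  case (insert a I)
  have "0 \<le> f a * sum f I"
    by (intro mult_nonneg_nonneg sum_nonneg) (use insert.prems in auto)
  then show ?case
    using insert by (auto simp: power2_sum algebra_simps)
qed simp

lemma norm_vec_squared: "(norm (x :: real^'n))\<^sup>2 = (\<Sum>i\<in>UNIV. (x$i)\<^sup>2)"
  unfolding power2_norm_eq_inner inner_vec_def by (simp add: power2_eq_square)

lemma inner_mult_symmetric:
  fixes M :: "real^'n^'n"
  assumes "transpose M = M"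
  shows "x \<bullet> (M *v y) = (M *v x) \<bullet> y"
  by (metis assms dot_lmul_matrix transpose_matrix_vector)

definition abs_vec :: "real^'n \<Rightarrow> real^'n" where
  "abs_vec x = (\<chi> i. \<bar>x$i\<bar>)"

lemma norm_abs_vec [simp]: "norm (abs_vec x) = norm x"
  by (simp add: abs_vec_def norm_vec_def L2_set_def)

lemma quadratic_form_abs_vec:
  fixes M :: "real^'n^'n"
  assumes "\<And>i j. 0 \<le> M$i$j"
  shows "\<bar>x \<bullet> (M *v x)\<bar> \<le> abs_vec x \<bullet> (M *v abs_vec x)"
proof -
  have "\<bar>x \<bullet> (M *v x)\<bar> = \<bar>\<Sum>i\<in>UNIV. \<Sum>j\<in>UNIV. x$i * (M$i$j * x$j)\<bar>"
    by (simp add: inner_vec_def matrix_vector_mult_def sum_distrib_left)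
  also have "\<dots> \<le> (\<Sum>i\<in>UNIV. \<Sum>j\<in>UNIV. \<bar>x$i * (M$i$j * x$j)\<bar>)"
    by (intro order_trans[OF sum_abs] sum_mono) auto
  also have "\<dots> = abs_vec x \<bullet> (M *v abs_vec x)"
    by (simp add: inner_vec_def matrix_vector_mult_def sum_distrib_left abs_vec_def abs_mult assms)
  finally show ?thesis .
qed

text \<open>Nonnegative entries turn the one-sided bound into a bound on the absolute value of the
  form, by passing to \<open>abs_vec\<close>. Polarization and the parallelogram law then bound
  \<open>u \<bullet> (M *v w)\<close> for unit vectors; taking \<open>w\<close> along
  \<open>x\<close> and \<open>u\<close> along its image gives the norm.\<close>

lemma norm_mult_le_of_quadratic_form:
  fixes M :: "real^'n^'n"
  assumes sym: "transpose M = M" and nonneg: "\<And>i j. 0 \<le> M$i$j"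
    and Q: "\<And>x. x \<bullet> (M *v x) \<le> \<mu> * (norm x)\<^sup>2"
  shows "norm (M *v x) \<le> \<mu> * norm x"
proof -
  have absQ: "\<bar>y \<bullet> (M *v y)\<bar> \<le> \<mu> * (norm y)\<^sup>2" for y
    using order_trans[OF quadratic_form_abs_vec[OF nonneg] Q[of "abs_vec y"]] by simp
  have mu: "0 \<le> \<mu>"
    using absQ[of "axis undefined 1"] by (simp add: norm_axis_1)
  have unit: "u \<bullet> (M *v w) \<le> \<mu>" if "norm u = 1" "norm w = 1" for u w
  proof -
    have "4 * (u \<bullet> (M *v w)) = (u + w) \<bullet> (M *v (u + w)) - (u - w) \<bullet> (M *v (u - w))"
      using inner_mult_symmetric[OF sym, of w u]
      by (simp add: algebra_simps inner_commute)
    also have "\<dots> \<le> \<mu> * (norm (u + w))\<^sup>2 + \<mu> * (norm (u - w))\<^sup>2"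
      using absQ[of "u + w"] absQ[of "u - w"] by linarith
    also have "\<dots> = \<mu> * (2 * (norm u)\<^sup>2 + 2 * (norm w)\<^sup>2)"
      by (simp add: power2_norm_eq_inner algebra_simps inner_commute)
    finally show ?thesis using that by simp
  qed
  show ?thesis
  proof (cases "x = 0 \<or> M *v x = 0")
    case True
    then show ?thesis using mu by auto
  next
    case False
    have "(M *v x) \<bullet> (M *v x) / (norm (M *v x) * norm x) \<le> \<mu>"
      using unit[of "(M *v x) /\<^sub>R norm (M *v x)" "x /\<^sub>R norm x"] False
      by (simp add: matrix_vector_mult_scaleR divide_simps mult.commute[of "norm x"])
    moreover have "(M *v x) \<bullet> (M *v x) / (norm (M *v x) * norm x) = norm (M *v x) / norm x"
      using False by (metis dot_square_norm mult_divide_mult_cancel_left norm_eq_zero power2_eq_square)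
    ultimately show ?thesis
      using False by (simp add: pos_divide_le_eq)
  qed
qed

text \<open>First-order variation: moving \<open>v\<close> by \<open>t\<close> times the residual
  \<open>w\<close> changes the form minus \<open>\<mu>\<close> times the squared norm by
  \<open>2 t |w|^2 - c t^2\<close>. This would be positive for small positive \<open>t\<close>
  unless \<open>w = 0\<close>.\<close>

lemma eigenvector_of_maximal_quadratic_form:
  fixes M :: "real^'n^'n"
  assumes sym: "transpose M = M" and V: "subspace V" and inv: "\<And>x. x \<in> V \<Longrightarrow> M *v x \<in> V"
    and Q: "\<And>x. x \<in> V \<Longrightarrow> x \<bullet> (M *v x) \<le> \<mu> * (norm x)\<^sup>2"
    and v: "v \<in> V" "v \<bullet> (M *v v) = \<mu> * (norm v)\<^sup>2"
  shows "M *v v = \<mu> *\<^sub>R v"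
proof -
  define w where "w = M *v v - \<mu> *\<^sub>R v"
  have wV: "w \<in> V" unfolding w_def using V v inv by (simp add: subspace_diff subspace_scale)
  define c where "c = \<mu> * (norm w)\<^sup>2 - w \<bullet> (M *v w)"
  have c0: "0 \<le> c" using Q[OF wV] by (simp add: c_def)
  have key: "2 * t * (norm w)\<^sup>2 \<le> t\<^sup>2 * c" for t
  proof -
    have "v + t *\<^sub>R w \<in> V" using V v wV by (simp add: subspace_add subspace_scale)
    moreover have "(norm (v + t *\<^sub>R w))\<^sup>2 = (norm v)\<^sup>2 + 2 * t * (w \<bullet> v) + t\<^sup>2 * (norm w)\<^sup>2"
      unfolding power2_norm_eq_inner
      by (simp add: algebra_simps inner_commute power2_eq_square[of t])
    ultimately have "v \<bullet> (M *v v) + 2 * t * (w \<bullet> (M *v v)) + t\<^sup>2 * (w \<bullet> (M *v w))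
        \<le> \<mu> * ((norm v)\<^sup>2 + 2 * t * (w \<bullet> v) + t\<^sup>2 * (norm w)\<^sup>2)"
      using inner_mult_symmetric[OF sym, of w v] Q[of "v + t *\<^sub>R w"]
      by (simp add: algebra_simps inner_commute power2_eq_square[of t])
    then have "2 * t * (w \<bullet> (M *v v) - \<mu> * (w \<bullet> v)) \<le> t\<^sup>2 * c"
      using v by (simp add: c_def algebra_simps)
    moreover have "w \<bullet> (M *v v) - \<mu> * (w \<bullet> v) = (norm w)\<^sup>2"
      by (simp add: w_def power2_norm_eq_inner inner_diff_right)
    ultimately show ?thesis by simp
  qed
  have "w = 0"
  proof (rule ccontr)
    assume "w \<noteq> 0"
    then have pos: "0 < (norm w)\<^sup>2" by simp
    \<comment> \<open>The denominator is \<open>c + 1\<close> because \<open>c\<close> may be zero;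
      this \<open>t\<close> keeps \<open>t * c\<close> at most \<open>|w|^2\<close>.\<close>
    define t where "t = (norm w)\<^sup>2 / (c + 1)"
    have "0 < t" using pos c0 by (simp add: t_def)
    have "2 * (norm w)\<^sup>2 \<le> t * c"
      using key[of t] \<open>0 < t\<close> by (simp add: power2_eq_square)
    also have "\<dots> \<le> (norm w)\<^sup>2" using c0 by (simp add: t_def field_simps)
    finally show False using pos by simp
  qed
  then show ?thesis by (simp add: w_def)
qed

text \<open>The form attains its maximum on the compact unit sphere of \<open>V\<close>, and a
  maximizer is an eigenvector. With \<open>V\<close> the complement of a top eigenvector this will
  give the second eigenvalue.\<close>

lemma exists_top_eigenvector:
  fixes M :: "real^'n^'n"
  assumes sym: "transpose M = M" and V: "subspace V" and inv: "\<And>x. x \<in> V \<Longrightarrow> M *v x \<in> V"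
    and ne: "V \<noteq> {0}"
  obtains v \<mu> where "v \<in> V" "norm v = 1" "M *v v = \<mu> *\<^sub>R v"
    "\<And>x. x \<in> V \<Longrightarrow> x \<bullet> (M *v x) \<le> \<mu> * (norm x)\<^sup>2"
proof -
  have cpt: "compact (V \<inter> sphere 0 1)"
    using V by (simp add: closed_subspace closed_Int_compact)
  obtain y where y: "y \<in> V" "y \<noteq> 0" using ne V subspace_0 by blast
  then have "y /\<^sub>R norm y \<in> V \<inter> sphere 0 1" using V by (simp add: subspace_scale)
  then have ne': "V \<inter> sphere 0 1 \<noteq> {}" by blast
  have cont: "continuous_on (V \<inter> sphere 0 1) (\<lambda>x. x \<bullet> (M *v x))"
    by (intro continuous_intros linear_continuous_on matrix_vector_mul_bounded_linear)
  obtain v where v: "v \<in> V" "norm v = 1"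
    and max: "\<And>x. x \<in> V \<Longrightarrow> norm x = 1 \<Longrightarrow> x \<bullet> (M *v x) \<le> v \<bullet> (M *v v)"
    using continuous_attains_sup[OF cpt ne' cont] by auto
  define \<mu> where "\<mu> = v \<bullet> (M *v v)"
  have Q: "x \<bullet> (M *v x) \<le> \<mu> * (norm x)\<^sup>2" if "x \<in> V" for x
  proof (cases "x = 0")
    case False
    then have "(x \<bullet> (M *v x)) / (norm x)\<^sup>2 \<le> \<mu>"
      using max[of "x /\<^sub>R norm x"] V that
      by (simp add: subspace_scale matrix_vector_mult_scaleR \<mu>_def divide_simps power2_eq_square)
    then show ?thesis using False by (simp add: field_simps)
  qed simp
  show thesis
    using that[OF v eigenvector_of_maximal_quadratic_form[OF sym V inv Q v(1)] Q] v
    by (simp add: \<mu>_def)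
qed

text \<open>Entrywise absolute values do not lower the quadratic form, so \<open>abs_vec v\<close>
  is a maximizer along with \<open>v\<close> and hence an eigenvector.\<close>

lemma perron_vector:
  fixes M :: "real^'n^'n"
  assumes sym: "transpose M = M" and nonneg: "\<And>i j. 0 \<le> M$i$j"
  obtains x \<mu> where "norm x = 1" "\<And>i. 0 \<le> x$i" "M *v x = \<mu> *\<^sub>R x"
    "\<And>y. norm (M *v y) \<le> \<mu> * norm y" "0 \<le> \<mu>"
proof -
  have "(UNIV :: (real^'n) set) \<noteq> {0}"
    by (metis UNIV_I singletonD axis_eq_0_iff zero_neq_one)
  then obtain v \<mu> where v: "norm v = 1" "M *v v = \<mu> *\<^sub>R v"
    and Q: "\<And>x. x \<bullet> (M *v x) \<le> \<mu> * (norm x)\<^sup>2"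
    using exists_top_eigenvector[OF sym subspace_UNIV] by (metis UNIV_I)
  have "\<mu> = v \<bullet> (M *v v)"
    using v by (simp add: power2_norm_eq_inner[symmetric])
  also have "\<dots> \<le> abs_vec v \<bullet> (M *v abs_vec v)"
    using quadratic_form_abs_vec[OF nonneg, of v] by linarith
  finally have "abs_vec v \<bullet> (M *v abs_vec v) = \<mu> * (norm (abs_vec v))\<^sup>2"
    using Q[of "abs_vec v"] v by simp
  then have "M *v abs_vec v = \<mu> *\<^sub>R abs_vec v"
    using eigenvector_of_maximal_quadratic_form[OF sym subspace_UNIV _ Q] by simp
  moreover have nb: "norm (M *v y) \<le> \<mu> * norm y" for y
    by (rule norm_mult_le_of_quadratic_form[OF sym nonneg Q])
  moreover have "0 \<le> \<mu>"
    using order_trans[OF norm_ge_zero nb[of v]] v(1) by simp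
  moreover have "norm (abs_vec v) = 1" "\<And>i. 0 \<le> abs_vec v $ i"
    using v(1) by (simp, simp add: abs_vec_def)
  ultimately show thesis
    using that[of "abs_vec v" \<mu>] v(1) by blast
qed

lemma bessel_inequality:
  fixes x :: "'a::euclidean_space"
  assumes fin: "finite B" and orth: "pairwise orthogonal B" and unit: "\<And>b. b \<in> B \<Longrightarrow> norm b = 1"
  shows "(\<Sum>b\<in>B. (b \<bullet> x)\<^sup>2) \<le> (norm x)\<^sup>2"
proof -
  \<comment> \<open>The projection of \<open>x\<close> to the span of \<open>B\<close>. It satisfies
    \<open>p \<bullet> p = p \<bullet> x\<close>, so the claim is that \<open>|x - p|^2\<close> is
    nonnegative.\<close>
  define p where "p = (\<Sum>b\<in>B. (b \<bullet> x) *\<^sub>R b)"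
  have bp: "b \<bullet> p = b \<bullet> x" if "b \<in> B" for b
  proof -
    have "b \<bullet> p = (\<Sum>c\<in>B. (c \<bullet> x) * (b \<bullet> c))" by (simp add: p_def inner_sum_right)
    also have "\<dots> = (\<Sum>c\<in>B. if c = b then b \<bullet> x else 0)"
    proof (rule sum.cong[OF refl])
      fix c assume "c \<in> B"
      then show "(c \<bullet> x) * (b \<bullet> c) = (if c = b then b \<bullet> x else 0)"
        using that orth unit[of b] by (auto simp: pairwise_def orthogonal_def norm_eq_1)
    qed
    finally show ?thesis using that fin by simp
  qed
  have px: "p \<bullet> x = (\<Sum>b\<in>B. (b \<bullet> x)\<^sup>2)"
    by (simp add: p_def inner_sum_left power2_eq_square)
  have "p \<bullet> p = (\<Sum>b\<in>B. (b \<bullet> x) * (b \<bullet> p))"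
    by (subst (1) p_def) (simp add: inner_sum_left)
  also have "\<dots> = p \<bullet> x" unfolding px by (rule sum.cong) (simp_all add: bp power2_eq_square)
  finally have "0 \<le> (norm x)\<^sup>2 - p \<bullet> x"
    using inner_ge_zero[of "x - p"] by (simp add: power2_norm_eq_inner algebra_simps inner_commute)
  then show ?thesis by (simp add: px)
qed

section \<open>Principal submatrices\<close>

text \<open>Deleted rows and columns are filled with zeros instead of being removed, so that all
  principal submatrices act on one space and can be compared.\<close>

definition restrict_matrix :: "real^'n^'n \<Rightarrow> 'n set \<Rightarrow> real^'n^'n" where
  "restrict_matrix A S = (\<chi> i j. if i \<in> S \<and> j \<in> S then A$i$j else 0)"

abbreviation matrix_iterate :: "real^'n^'n \<Rightarrow> nat \<Rightarrow> real^'n \<Rightarrow> real^'n" where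
  "matrix_iterate M k \<equiv> ((*v) M) ^^ k"

lemma symmetric_matrix_nth: "transpose A = A \<Longrightarrow> A$i$j = A$j$i"
  by (auto simp: transpose_def vec_eq_iff)

lemma restrict_matrix_symmetric:
  "transpose A = A \<Longrightarrow> transpose (restrict_matrix A S) = restrict_matrix A S"
  by (auto simp: restrict_matrix_def transpose_def vec_eq_iff)

lemma restrict_matrix_mult_nth:
  "(restrict_matrix A S *v x) $ i = (if i \<in> S then \<Sum>j\<in>S. A$i$j * x$j else 0)"
proof -
  have "(\<Sum>j\<in>UNIV. (if j \<in> S then A$i$j else 0) * x$j) = (\<Sum>j\<in>S. A$i$j * x$j)"
    by (rule sum.mono_neutral_cong_right) auto
  then show ?thesis by (simp add: restrict_matrix_def matrix_vector_mult_def)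
qed

lemma matrix_mult_nonneg:
  fixes M :: "real^'n^'n"
  assumes "\<And>i j. 0 \<le> M$i$j" "\<And>i. 0 \<le> x$i"
  shows "0 \<le> (M *v x)$i"
  by (simp add: matrix_vector_mult_def assms sum_nonneg)

lemma matrix_iterate_nonneg:
  assumes "\<And>i j. 0 \<le> M$i$j" "\<And>i. 0 \<le> x$i"
  shows "0 \<le> (matrix_iterate M k x)$i"
  using assms(2) by (induction k arbitrary: i) (auto intro: matrix_mult_nonneg assms(1))

lemma matrix_iterate_add:
  "matrix_iterate M k (x + y) = matrix_iterate M k x + matrix_iterate M k y"
  by (induction k) (simp_all add: matrix_vector_right_distrib)

lemma matrix_iterate_eigenvector:
  "M *v x = \<mu> *\<^sub>R x \<Longrightarrow> matrix_iterate M k x = \<mu> ^ k *\<^sub>R x"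
  by (induction k) (simp_all add: matrix_vector_mult_scaleR mult.commute)

lemma inner_matrix_iterate:
  "transpose M = M \<Longrightarrow> x \<bullet> matrix_iterate M k y = matrix_iterate M k x \<bullet> y"
proof (induction k arbitrary: x)
  case (Suc k)
  have "x \<bullet> matrix_iterate M (Suc k) y = (M *v x) \<bullet> matrix_iterate M k y"
    by (simp add: inner_mult_symmetric[OF Suc.prems])
  also have "\<dots> = matrix_iterate M k (M *v x) \<bullet> y" by (rule Suc.IH[OF Suc.prems])
  finally show ?case by (simp add: funpow_swap1)
qed simp

lemma norm_matrix_iterate_le:
  assumes "\<And>y. norm (M *v y) \<le> \<mu> * norm y" and "0 \<le> \<mu>"
  shows "norm (matrix_iterate M k y) \<le> \<mu> ^ k * norm y"
proof (induction k)
  case (Suc k)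
  have "norm (matrix_iterate M (Suc k) y) \<le> \<mu> * norm (matrix_iterate M k y)"
    using assms(1) by simp
  also have "\<dots> \<le> \<mu> * (\<mu> ^ k * norm y)"
    using Suc assms(2) by (rule mult_left_mono)
  finally show ?case by (simp add: mult_ac)
qed simp

section \<open>Gain in norm when a vertex set is enlarged\<close>

text \<open>Send each \<open>u\<close> in \<open>X\<close> to one neighbour in \<open>Y\<close>. The
  entries arriving at \<open>v\<close> have squares summing to at most the square of their sum, and
  that sum is part of \<open>(M *v x)$v\<close>.\<close>

lemma sum_squares_le_sum_squares_mult:
  fixes M :: "real^'n^'n"
  assumes nonneg: "\<And>i j. 0 \<le> M$i$j" and x: "\<And>i. 0 \<le> x$i"
    and nbr: "\<And>u. u \<in> X \<Longrightarrow> \<exists>v\<in>Y. 1 \<le> M$v$u"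
  shows "(\<Sum>u\<in>X. (x$u)\<^sup>2) \<le> (\<Sum>v\<in>Y. ((M *v x)$v)\<^sup>2)"
proof -
  obtain g where g: "g u \<in> Y" "1 \<le> M$(g u)$u" if "u \<in> X" for u
    using nbr by metis
  have "(\<Sum>u\<in>X. (x$u)\<^sup>2) = (\<Sum>v\<in>Y. \<Sum>u\<in>{u\<in>X. g u = v}. (x$u)\<^sup>2)"
    by (rule sum.group[symmetric]) (use g in auto)
  also have "\<dots> \<le> (\<Sum>v\<in>Y. ((M *v x)$v)\<^sup>2)"
  proof (rule sum_mono)
    fix v assume "v \<in> Y"
    have "(\<Sum>u\<in>{u\<in>X. g u = v}. (x$u)\<^sup>2) \<le> (\<Sum>u\<in>{u\<in>X. g u = v}. x$u)\<^sup>2"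
      by (rule sum_squares_le_square_sum) (use x in auto)
    also have "\<dots> \<le> ((M *v x)$v)\<^sup>2"
    proof (rule power_mono)
      have "(\<Sum>u\<in>{u\<in>X. g u = v}. x$u) \<le> (\<Sum>u\<in>{u\<in>X. g u = v}. M$v$u * x$u)"
      proof (rule sum_mono)
        fix u assume "u \<in> {u\<in>X. g u = v}"
        then have "1 * x$u \<le> M$v$u * x$u" using g x by (intro mult_right_mono) auto
        then show "x$u \<le> M$v$u * x$u" by simp
      qed
      also have "\<dots> \<le> (\<Sum>u\<in>UNIV. M$v$u * x$u)"
        by (rule sum_mono2) (auto simp: nonneg x)
      finally show "(\<Sum>u\<in>{u\<in>X. g u = v}. x$u) \<le> (M *v x)$v"
        by (simp add: matrix_vector_mult_def)
    qed (simp add: sum_nonneg x)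
    finally show "(\<Sum>u\<in>{u\<in>X. g u = v}. (x$u)\<^sup>2) \<le> ((M *v x)$v)\<^sup>2" .
  qed
  finally show ?thesis .
qed

text \<open>One step does not shrink the norm, since every vertex of the support passes its entry to
  a neighbour. The image again lives on vertices with a neighbour, so the step can be
  iterated.\<close>

lemma norm_le_norm_matrix_iterate:
  fixes M :: "real^'n^'n"
  assumes sym: "transpose M = M" and M01: "\<And>i j. M$i$j \<in> {0, 1}"
    and x: "\<And>i. 0 \<le> x$i" and nbr: "\<And>i. x$i \<noteq> 0 \<Longrightarrow> \<exists>j. M$i$j = 1"
  shows "norm x \<le> norm (matrix_iterate M k x)"
  using x nbr
proof (induction k arbitrary: x)
  case (Suc k)
  have M0: "0 \<le> M$i$j" for i j using M01[of i j] by auto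
  have comm: "M$i$j = M$j$i" for i j using sym by (rule symmetric_matrix_nth)
  have "(norm x)\<^sup>2 = (\<Sum>i\<in>{i. x$i \<noteq> 0}. (x$i)\<^sup>2)"
    unfolding norm_vec_squared by (rule sum.mono_neutral_right) auto
  also have "\<dots> \<le> (norm (M *v x))\<^sup>2"
    unfolding norm_vec_squared
    by (rule sum_squares_le_sum_squares_mult)
      (use M0 Suc.prems comm in \<open>auto, metis order_refl\<close>)
  finally have "norm x \<le> norm (M *v x)" by simp
  also have "\<dots> \<le> norm (matrix_iterate M k (M *v x))"
  proof (rule Suc.IH)
    show "0 \<le> (M *v x)$i" for i by (rule matrix_mult_nonneg[OF M0 Suc.prems(1)])
    show "\<exists>j. M$i$j = 1" if "(M *v x)$i \<noteq> 0" for i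
    proof (rule ccontr)
      assume "\<nexists>j. M$i$j = 1"
      then have "M$i$j = 0" for j using M01[of i j] by auto
      then show False using that by (simp add: matrix_vector_mult_def)
    qed
  qed
  finally show ?case by (simp add: funpow_swap1)
qed simp

text \<open>
  For adjacency matrices, \<open>near A U W k\<close> consists of the vertices of \<open>W\<close> from which \<open>U - W\<close> can be
  reached inside \<open>U\<close> in between 1 and \<open>k\<close> steps.
\<close>

fun near :: "real^'n^'n \<Rightarrow> 'n set \<Rightarrow> 'n set \<Rightarrow> nat \<Rightarrow> 'n set" where
  "near A U W 0 = {}"
| "near A U W (Suc k) = {u \<in> W. \<exists>v \<in> near A U W k \<union> (U - W). A$u$v = 1}"

lemma near_subset: "near A U W k \<subseteq> W"
  by (cases k) auto

text \<open>Each vertex of \<open>near\<close> has a walk that leaves \<open>W\<close> within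
  \<open>k\<close> steps, and the matrix of \<open>U\<close> sees this walk while that of
  \<open>W\<close> does not. The induction splits the first step by whether it stays in
  \<open>W\<close>.\<close>

lemma restrict_matrix_iterate_gain:
  fixes A :: "real^'n^'n"
  assumes sym: "transpose A = A" and A01: "\<And>i j. A$i$j \<in> {0, 1}" and WU: "W \<subseteq> U"
    and x: "\<And>i. 0 \<le> x$i" and supp: "\<And>i. i \<notin> W \<Longrightarrow> x$i = 0"
  shows "(\<Sum>u\<in>near A U W k. (x$u)\<^sup>2) + (norm (matrix_iterate (restrict_matrix A W) k x))\<^sup>2
    \<le> (norm (matrix_iterate (restrict_matrix A U) k x))\<^sup>2"
  using x supp
proof (induction k arbitrary: x)
  case (Suc k)
  let ?MW = "restrict_matrix A W" and ?MU = "restrict_matrix A U"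
  have comm: "A$i$j = A$j$i" for i j using sym by (rule symmetric_matrix_nth)
  have M01: "restrict_matrix A S $i$j \<in> {0, 1}" for S i j
    using A01 by (simp add: restrict_matrix_def)
  then have M0: "0 \<le> restrict_matrix A S $i$j" for S i j
    by (metis insertE order_refl singletonD zero_le_one)
  define y where "y = ?MW *v x"
  \<comment> \<open>The part of the first step that leaves \<open>W\<close>; it is supported on
    \<open>U - W\<close>.\<close>
  define z where "z = ?MU *v x - ?MW *v x"
  have MUx: "(?MU *v x)$i = (\<Sum>j\<in>W. A$i$j * x$j)" if "i \<in> U" for i
    unfolding restrict_matrix_mult_nth using that WU Suc.prems(2)
    by (auto intro!: sum.mono_neutral_right)
  have z_nth: "z$i = (if i \<in> U - W then (?MU *v x)$i else 0)" for i
    using MUx[of i] WU by (auto simp: z_def restrict_matrix_mult_nth)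
  have z0: "0 \<le> z$i" for i
    by (simp add: z_nth matrix_mult_nonneg M0 Suc.prems(1))
  have y0: "0 \<le> y$i" for i unfolding y_def by (rule matrix_mult_nonneg[OF M0 Suc.prems(1)])
  have ysupp: "y$i = 0" if "i \<notin> W" for i using that by (simp add: y_def restrict_matrix_mult_nth)
  have yW: "y$i = (?MU *v x)$i" if "i \<in> W" for i
    using that WU MUx[of i] by (auto simp: y_def restrict_matrix_mult_nth)
  \<comment> \<open>Along one edge, every vertex of level \<open>Suc k\<close> reaches level
    \<open>k\<close>, where the induction hypothesis takes over, or \<open>U - W\<close>, where
    \<open>z\<close> records it.\<close>
  have "(\<Sum>u\<in>near A U W (Suc k). (x$u)\<^sup>2)
      \<le> (\<Sum>v\<in>near A U W k \<union> (U - W). ((?MU *v x)$v)\<^sup>2)"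
  proof (rule sum_squares_le_sum_squares_mult)
    fix u assume u: "u \<in> near A U W (Suc k)"
    then obtain v where v: "v \<in> near A U W k \<union> (U - W)" "A$u$v = 1" by auto
    then have "u \<in> U" "v \<in> U" using u WU near_subset[of A U W k] by auto
    then have "?MU$v$u = 1" using v comm by (simp add: restrict_matrix_def)
    then show "\<exists>v\<in>near A U W k \<union> (U - W). 1 \<le> ?MU$v$u"
      using v(1) by (metis order_refl)
  qed (use M0 Suc.prems in auto)
  also have "\<dots> = (\<Sum>v\<in>near A U W k. ((?MU *v x)$v)\<^sup>2) + (\<Sum>v\<in>U - W. ((?MU *v x)$v)\<^sup>2)"
    by (rule sum.union_disjoint) (use near_subset[of A U W k] in auto)
  also have "(\<Sum>v\<in>near A U W k. ((?MU *v x)$v)\<^sup>2) = (\<Sum>v\<in>near A U W k. (y$v)\<^sup>2)"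
    by (rule sum.cong) (use near_subset[of A U W k] yW in auto)
  also have "(\<Sum>v\<in>U - W. ((?MU *v x)$v)\<^sup>2) = (norm z)\<^sup>2"
    unfolding norm_vec_squared by (rule sum.mono_neutral_cong_left) (auto simp: z_nth)
  finally have 1: "(\<Sum>u\<in>near A U W (Suc k). (x$u)\<^sup>2) \<le> (\<Sum>v\<in>near A U W k. (y$v)\<^sup>2) + (norm z)\<^sup>2" .
  have "norm z \<le> norm (matrix_iterate ?MU k z)"
  proof (rule norm_le_norm_matrix_iterate[OF restrict_matrix_symmetric[OF sym] M01 z0])
    fix i assume "z$i \<noteq> 0"
    then have "i \<in> U" "(\<Sum>j\<in>W. A$i$j * x$j) \<noteq> 0"
      using MUx[of i] by (auto simp: z_nth split: if_splits)
    then obtain j where "j \<in> W" "A$i$j * x$j \<noteq> 0" by (meson sum.neutral)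
    then show "\<exists>j. ?MU$i$j = 1"
      using A01[of i j] \<open>i \<in> U\<close> WU by (auto simp: restrict_matrix_def)
  qed
  then have 2: "(norm z)\<^sup>2 \<le> (norm (matrix_iterate ?MU k z))\<^sup>2" by simp
  have 3: "(\<Sum>v\<in>near A U W k. (y$v)\<^sup>2) + (norm (matrix_iterate ?MW k y))\<^sup>2
      \<le> (norm (matrix_iterate ?MU k y))\<^sup>2"
    by (rule Suc.IH[OF y0 ysupp])
  \<comment> \<open>Nonnegative entries make the cross term nonnegative, so the two squared norms
    may simply be added.\<close>
  have "0 \<le> matrix_iterate ?MU k y \<bullet> matrix_iterate ?MU k z"
    unfolding inner_vec_def
    by (simp add: sum_nonneg matrix_iterate_nonneg M0 y0 z0)
  then have 4: "(norm (matrix_iterate ?MU k y))\<^sup>2 + (norm (matrix_iterate ?MU k z))\<^sup>2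
      \<le> (norm (matrix_iterate ?MU k (y + z)))\<^sup>2"
    unfolding matrix_iterate_add power2_norm_eq_inner
    by (simp add: algebra_simps inner_commute)
  have yz: "?MU *v x = y + z" by (simp add: y_def z_def)
  have "matrix_iterate M (Suc k) x = matrix_iterate M k (M *v x)" for M :: "real^'n^'n"
    by (simp add: funpow_swap1)
  then show ?case
    using 1 2 3 4 by (simp only: y_def[symmetric] yz)
qed simp

text \<open>From \<open>2 * a * b \<le> a^2 + b^2\<close> and symmetry. Only rows in the support of
  \<open>y\<close> are constrained, so that the vertices of \<open>near\<close> can be masked out
  below.\<close>

lemma quadratic_form_le_row_sum:
  fixes M :: "real^'n^'n"
  assumes sym: "transpose M = M" and nonneg: "\<And>i j. 0 \<le> M$i$j"
    and row: "\<And>i. y$i \<noteq> 0 \<Longrightarrow> (\<Sum>j\<in>UNIV. M$i$j) \<le> c"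
  shows "y \<bullet> (M *v y) \<le> c * (norm y)\<^sup>2"
proof -
  have comm: "M$i$j = M$j$i" for i j using sym by (rule symmetric_matrix_nth)
  have "2 * (y \<bullet> (M *v y)) = (\<Sum>i\<in>UNIV. \<Sum>j\<in>UNIV. M$i$j * (2 * y$i * y$j))"
    by (simp add: inner_vec_def matrix_vector_mult_def sum_distrib_left algebra_simps)
  also have "\<dots> \<le> (\<Sum>i\<in>UNIV. \<Sum>j\<in>UNIV. M$i$j * ((y$i)\<^sup>2 + (y$j)\<^sup>2))"
    by (intro sum_mono mult_left_mono sum_squares_bound nonneg)
  also have "\<dots> = (\<Sum>i\<in>UNIV. \<Sum>j\<in>UNIV. M$i$j * (y$i)\<^sup>2) + (\<Sum>i\<in>UNIV. \<Sum>j\<in>UNIV. M$i$j * (y$j)\<^sup>2)"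
    by (simp add: algebra_simps sum.distrib)
  also have "(\<Sum>i\<in>UNIV. \<Sum>j\<in>UNIV. M$i$j * (y$j)\<^sup>2) = (\<Sum>i\<in>UNIV. \<Sum>j\<in>UNIV. M$i$j * (y$i)\<^sup>2)"
    by (subst sum.swap) (simp add: comm)
  finally have "y \<bullet> (M *v y) \<le> (\<Sum>i\<in>UNIV. (\<Sum>j\<in>UNIV. M$i$j) * (y$i)\<^sup>2)"
    by (simp add: sum_distrib_right)
  also have "\<dots> \<le> (\<Sum>i\<in>UNIV. c * (y$i)\<^sup>2)"
  proof (rule sum_mono)
    fix i show "(\<Sum>j\<in>UNIV. M$i$j) * (y$i)\<^sup>2 \<le> c * (y$i)\<^sup>2"
      using row[of i] by (cases "y$i = 0") (auto intro: mult_right_mono)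
  qed
  also have "\<dots> = c * (norm y)\<^sup>2" by (simp add: norm_vec_squared sum_distrib_left)
  finally show ?thesis .
qed

text \<open>It suffices to bound the largest eigenvalue \<open>\<mu>\<close> of the smaller matrix.
  Either \<open>\<mu>\<close> is already \<open>1/2\<close> below \<open>\<theta>\<close>, or its
  Perron vector has enough mass on \<open>near\<close> for the gain in \<open>U\<close> to separate
  the powers.\<close>

lemma norm_restrict_matrix_iterate_le:
  fixes A :: "real^'n^'n"
  assumes sym: "transpose A = A" and A01: "\<And>i j. A$i$j \<in> {0, 1}" and WU: "W \<subseteq> U"
    and lam: "1 \<le> \<theta>" and k: "1 \<le> k"
    and Q: "\<And>x. x \<bullet> (restrict_matrix A U *v x) \<le> \<theta> * (norm x)\<^sup>2"
    and deg: "\<And>v. v \<in> W - near A U W k \<Longrightarrow> (\<Sum>u\<in>UNIV. A$v$u) \<le> \<theta> - 1"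
  shows "(norm (matrix_iterate (restrict_matrix A W) k y))\<^sup>2
    \<le> (\<theta> ^ (2 * k) - 1 / (2 * \<theta>)) * (norm y)\<^sup>2"
proof -
  let ?MW = "restrict_matrix A W" and ?MU = "restrict_matrix A U" and ?N = "near A U W k"
  have A0: "0 \<le> A$i$j" for i j using A01[of i j] by auto
  have M0: "0 \<le> restrict_matrix A S $i$j" for S i j
    using A0 by (simp add: restrict_matrix_def)
  note symW = restrict_matrix_symmetric[OF sym, of W]
  obtain x \<mu> where x1: "norm x = 1" and x0: "\<And>i. 0 \<le> x$i" and ev: "?MW *v x = \<mu> *\<^sub>R x"
    and top: "\<And>y. norm (?MW *v y) \<le> \<mu> * norm y" and mu0: "0 \<le> \<mu>"
    using perron_vector[OF symW M0] by metis
  have "\<mu> ^ (2 * k) \<le> \<theta> ^ (2 * k) - 1 / (2 * \<theta>)"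
  proof (cases "\<mu> \<le> \<theta> - 1/2")
    case True
    \<comment> \<open>Replacing one of the \<open>2 * k\<close> factors \<open>\<theta>\<close> by
      \<open>\<theta> - 1/2\<close> loses \<open>\<theta> ^ m / 2\<close>, which is at least
      \<open>1 / (2 * \<theta>)\<close> as \<open>\<theta> \<ge> 1\<close>.\<close>
    obtain m where m: "2 * k = Suc m" using k by (cases "2 * k") auto
    have "\<mu> ^ Suc m \<le> (\<theta> - 1/2) * \<theta> ^ m"
      using True mu0 lam by (auto intro!: mult_mono power_mono)
    also have "\<dots> = \<theta> ^ Suc m - \<theta> ^ m / 2" by (simp add: field_simps)
    also have "\<dots> \<le> \<theta> ^ Suc m - 1 / (2 * \<theta>)"
    proof -
      have "1 / (2 * \<theta>) \<le> 1 / 2" using lam by (simp add: field_simps)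
      also have "\<dots> \<le> \<theta> ^ m / 2" using lam one_le_power[of \<theta> m] by simp
      finally show ?thesis by simp
    qed
    finally show ?thesis by (simp add: m)
  next
    case False
    then have mu: "\<theta> - 1/2 < \<mu>" by simp
    have supp: "x$i = 0" if "i \<notin> W" for i
    proof -
      have "\<mu> * x$i = 0"
        using arg_cong[OF ev, of "\<lambda>x. x$i"] that by (simp add: restrict_matrix_mult_nth)
      then show ?thesis using mu lam by simp
    qed
    \<comment> \<open>Split the Perron vector into its part on \<open>near\<close> and the rest
      \<open>w\<close>. All rows met by \<open>w\<close> have sum at most
      \<open>\<theta> - 1\<close>, which forces the mass \<open>\<epsilon>\<close> of
      \<open>z\<close> to be large.\<close>
    define z where "z = (\<chi> i. if i \<in> ?N then x$i else 0)"
    define w where "w = (\<chi> i. if i \<in> ?N then 0 else x$i)"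
    define \<epsilon> where "\<epsilon> = (\<Sum>u\<in>?N. (x$u)\<^sup>2)"
    have w_eq: "w = x - z" by (simp add: w_def z_def vec_eq_iff)
    have zx: "z \<bullet> x = \<epsilon>"
      unfolding inner_vec_def \<epsilon>_def
      by (rule sum.mono_neutral_cong_right) (auto simp: z_def power2_eq_square)
    have zz: "z \<bullet> z = \<epsilon>"
      unfolding inner_vec_def \<epsilon>_def
      by (rule sum.mono_neutral_cong_right) (auto simp: z_def power2_eq_square)
    have xx: "x \<bullet> x = 1" using x1 by (simp add: norm_eq_1)
    have "0 \<le> z \<bullet> (?MW *v z)"
      unfolding inner_vec_def
      by (auto intro!: sum_nonneg mult_nonneg_nonneg matrix_mult_nonneg M0 simp: z_def x0)
    moreover have "w \<bullet> (?MW *v w) = \<mu> - 2 * \<mu> * \<epsilon> + z \<bullet> (?MW *v z)"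
      using inner_mult_symmetric[OF symW, of x z] zx xx ev
      by (simp add: w_eq algebra_simps inner_commute)
    moreover have "w \<bullet> (?MW *v w) \<le> (\<theta> - 1) * (norm w)\<^sup>2"
    proof (rule quadratic_form_le_row_sum[OF symW M0])
      fix i assume "w$i \<noteq> 0"
      then have i: "i \<in> W - ?N" using supp by (auto simp: w_def split: if_splits)
      have "(\<Sum>j\<in>UNIV. ?MW$i$j) \<le> (\<Sum>j\<in>UNIV. A$i$j)"
        by (rule sum_mono) (simp add: restrict_matrix_def A0)
      then show "(\<Sum>j\<in>UNIV. ?MW$i$j) \<le> \<theta> - 1" using deg[OF i] by simp
    qed
    moreover have "(norm w)\<^sup>2 = 1 - \<epsilon>"
      unfolding power2_norm_eq_inner w_eq using xx zx zz by (simp add: algebra_simps inner_commute)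
    ultimately have *: "\<mu> - 2 * \<mu> * \<epsilon> \<le> (\<theta> - 1) * (1 - \<epsilon>)" by simp
    \<comment> \<open>The inequality above says \<open>\<mu> - \<theta> + 1 \<le> \<epsilon> * (2 *
      \<mu> - \<theta> + 1)\<close>. A smaller \<open>\<epsilon>\<close> would make
      \<open>(\<theta> - 1) * (2 * \<mu> - 2 * \<theta> + 1)\<close> negative, against
      \<open>\<mu> > \<theta> - 1/2\<close>.\<close>
    have eps: "1 / (2 * \<theta>) \<le> \<epsilon>"
    proof (rule ccontr)
      assume "\<not> 1 / (2 * \<theta>) \<le> \<epsilon>"
      then have "2 * \<theta> * \<epsilon> < 1" using lam by (simp add: field_simps)
      moreover have "0 < 2 * \<mu> - \<theta> + 1" using mu lam by simp
      ultimately have "(2 * \<theta> * \<epsilon>) * (2 * \<mu> - \<theta> + 1) < 2 * \<mu> - \<theta> + 1"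
        by simp
      moreover have "2 * \<theta> * (\<mu> - \<theta> + 1) \<le> 2 * \<theta> * (\<epsilon> * (2 * \<mu> - \<theta> + 1))"
        using * lam by (intro mult_left_mono) (auto simp: algebra_simps)
      ultimately have "(\<theta> - 1) * (2 * \<mu> - 2 * \<theta> + 1) < 0" by (simp add: algebra_simps)
      moreover have "0 \<le> (\<theta> - 1) * (2 * \<mu> - 2 * \<theta> + 1)"
        using lam mu by (intro mult_nonneg_nonneg) auto
      ultimately show False by simp
    qed
    have topU: "norm (?MU *v y) \<le> \<theta> * norm y" for y
      by (rule norm_mult_le_of_quadratic_form[OF restrict_matrix_symmetric[OF sym] M0 Q])
    have "\<epsilon> + (norm (matrix_iterate ?MW k x))\<^sup>2 \<le> (norm (matrix_iterate ?MU k x))\<^sup>2"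
      unfolding \<epsilon>_def by (rule restrict_matrix_iterate_gain[OF sym A01 WU x0 supp])
    also have "\<dots> \<le> (\<theta> ^ k * norm x)\<^sup>2"
      by (rule power_mono[OF norm_matrix_iterate_le[OF topU]]) (use lam in auto)
    finally have "\<epsilon> + (\<mu> ^ k)\<^sup>2 \<le> (\<theta> ^ k)\<^sup>2"
      using mu0 by (simp add: matrix_iterate_eigenvector[OF ev] x1)
    then show ?thesis using eps by (simp add: power_mult[symmetric] mult.commute)
  qed
  moreover have "(norm (matrix_iterate ?MW k y))\<^sup>2 \<le> (\<mu> ^ k * norm y)\<^sup>2"
    by (rule power_mono[OF norm_matrix_iterate_le[OF top mu0]]) simp
  moreover have "(\<mu> ^ k * norm y)\<^sup>2 = \<mu> ^ (2 * k) * (norm y)\<^sup>2"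
    by (simp add: power_mult_distrib power_mult[symmetric] mult.commute)
  ultimately show ?thesis
    by (smt (verit) mult_right_mono zero_le_power2)
qed

section \<open>The second eigenvalue and multiplicities\<close>

lemma subspace_eigenspace: "subspace (eigenspace A \<mu>)"
  by (auto simp: eigenspace_def subspace_def matrix_vector_right_distrib
      matrix_vector_mult_scaleR scaleR_right_distrib scaleR_left_commute)

lemma eigenvectors_orthogonal:
  fixes A :: "real^'n^'n"
  assumes "transpose A = A" "A *v x = \<mu> *\<^sub>R x" "A *v y = \<nu> *\<^sub>R y" "\<mu> \<noteq> \<nu>"
  shows "orthogonal x y"
  using inner_mult_symmetric[OF assms(1), of x y] assms(2-4) by (simp add: orthogonal_def)

text \<open>Eigenvectors of distinct eigenvalues are orthogonal, hence independent. Finiteness is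
  what lets \<open>sorted_list_of_set\<close> in \<open>eigenvalue_list\<close> enumerate the
  eigenvalues.\<close>

lemma finite_eigenvalues:
  fixes A :: "real^'n^'n"
  assumes sym: "transpose A = A"
  shows "finite {\<mu>. is_eigenvalue A \<mu>}"
proof -
  define f where "f \<mu> = (SOME x. x \<noteq> 0 \<and> A *v x = \<mu> *\<^sub>R x)" for \<mu>
  have "f \<mu> \<noteq> 0 \<and> A *v f \<mu> = \<mu> *\<^sub>R f \<mu>" if "is_eigenvalue A \<mu>" for \<mu>
    unfolding f_def using that unfolding is_eigenvalue_def by (rule someI_ex)
  then have f: "f \<mu> \<noteq> 0" "A *v f \<mu> = \<mu> *\<^sub>R f \<mu>" if "is_eigenvalue A \<mu>" for \<mu>
    using that by simp_all
  let ?E = "{\<mu>. is_eigenvalue A \<mu>}"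
  have inj: "inj_on f ?E"
    by (intro inj_onI) (metis f mem_Collect_eq scaleR_right_imp_eq)
  have "pairwise orthogonal (f ` ?E)"
    using f eigenvectors_orthogonal[OF sym] by (auto simp: pairwise_def) metis
  then have "independent (f ` ?E)"
    using f by (intro pairwise_orthogonal_independent) auto
  then show ?thesis using inj independent_imp_finite finite_imageD by blast
qed

lemma length_filter_concat_replicate:
  assumes "distinct xs"
  shows "length (filter P (concat (map (\<lambda>\<mu>. replicate (m \<mu>) \<mu>) xs)))
    = (\<Sum>\<mu>\<in>{\<mu>\<in>set xs. P \<mu>}. m \<mu>)"
  using assms
proof (induction xs)
  case (Cons a xs)
  have "{\<mu>\<in>set (a # xs). P \<mu>} = (if P a then insert a {\<mu>\<in>set xs. P \<mu>} else {\<mu>\<in>set xs. P \<mu>})"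
    by auto
  then show ?case using Cons by (auto simp: filter_replicate)
qed simp

lemma sorted_concat_replicate:
  "sorted xs \<Longrightarrow> sorted (concat (map (\<lambda>\<mu>. replicate (m \<mu>) \<mu>) xs))"
  by (induction xs) (auto simp: sorted_append sorted_replicate)

text \<open>The min-max principle for a plane: it contains a nonzero vector orthogonal to the top
  eigenvector \<open>v1\<close>, so the top eigenvalue on the complement of \<open>v1\<close> also
  exceeds \<open>\<theta>\<close>.\<close>

lemma second_eigenvalue_greater:
  fixes A :: "real^'n^'n"
  assumes sym: "transpose A = A"
    and Q: "\<And>a b. a \<noteq> 0 \<or> b \<noteq> 0 \<Longrightarrow> \<theta> * (norm (a *\<^sub>R x1 + b *\<^sub>R x2))\<^sup>2
      < (a *\<^sub>R x1 + b *\<^sub>R x2) \<bullet> (A *v (a *\<^sub>R x1 + b *\<^sub>R x2))"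
  shows "\<theta> < eigenvalue_list A ! 1"
proof -
  have "x1 \<noteq> 0" using Q[of 1 0] by auto
  then have "(UNIV :: (real^'n) set) \<noteq> {0}" by auto
  then obtain v1 \<mu>1 where v1: "norm v1 = 1" "A *v v1 = \<mu>1 *\<^sub>R v1"
    and Q1: "\<And>x. x \<bullet> (A *v x) \<le> \<mu>1 * (norm x)\<^sup>2"
    using exists_top_eigenvector[OF sym subspace_UNIV] by (metis UNIV_I)
  define V where "V = {y. orthogonal v1 y}"
  obtain a b where ab: "a \<noteq> 0 \<or> b \<noteq> 0" "v1 \<bullet> (a *\<^sub>R x1 + b *\<^sub>R x2) = 0"
  proof (cases "v1 \<bullet> x1 = 0")
    case True
    then show thesis using that[of 1 0] by simp
  next
    case False
    then show thesis using that[of "v1 \<bullet> x2" "- (v1 \<bullet> x1)"] by (simp add: inner_diff_right inner_add_right)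
  qed
  define w where "w = a *\<^sub>R x1 + b *\<^sub>R x2"
  have w: "\<theta> * (norm w)\<^sup>2 < w \<bullet> (A *v w)" using Q[OF ab(1)] by (simp add: w_def)
  then have w0: "w \<noteq> 0" by auto
  have wV: "w \<in> V" using ab by (simp add: V_def orthogonal_def w_def)
  have VA: "A *v x \<in> V" if "x \<in> V" for x
    using that inner_mult_symmetric[OF sym, of v1 x] v1 by (simp add: V_def orthogonal_def)
  obtain v2 \<mu>2 where v2: "v2 \<in> V" "norm v2 = 1" "A *v v2 = \<mu>2 *\<^sub>R v2"
    and Q2: "\<And>x. x \<in> V \<Longrightarrow> x \<bullet> (A *v x) \<le> \<mu>2 * (norm x)\<^sup>2"
  proof (rule exists_top_eigenvector[OF sym _ VA])
    show "subspace V" unfolding V_def by (rule subspace_orthogonal_to_vector)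
  qed (use w0 wV in auto)
  have "\<theta> * (norm w)\<^sup>2 < \<mu>1 * (norm w)\<^sup>2" "\<theta> * (norm w)\<^sup>2 < \<mu>2 * (norm w)\<^sup>2"
    using w Q1[of w] Q2[OF wV] by linarith+
  then have gt: "\<theta> < \<mu>1" "\<theta> < \<mu>2" using w0 by auto
  let ?E = "{\<mu>. is_eigenvalue A \<mu>}" and ?m = "eigenvalue_multiplicity A"
  let ?P = "\<lambda>\<mu>. \<theta> < \<mu>" and ?L = "eigenvalue_list A"
  have fin: "finite ?E" by (rule finite_eigenvalues[OF sym])
  have mem: "\<mu>1 \<in> ?E" "\<mu>2 \<in> ?E"
    using v1 v2 by (auto simp: is_eigenvalue_def) (metis norm_zero zero_neq_one)+
  have v12: "v1 \<noteq> v2" "orthogonal v1 v2"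
    using v1 v2 by (auto simp: V_def orthogonal_def)
  have ind: "independent {v1, v2}"
    using v1 v2 v12 by (intro pairwise_orthogonal_independent)
      (auto simp: pairwise_def orthogonal_commute)
  \<comment> \<open>If the two eigenvalues coincide, the sum has one term, and the orthogonal pair
    \<open>v1\<close>, \<open>v2\<close> makes it at least 2.\<close>
  have "2 \<le> (\<Sum>\<mu>\<in>{\<mu>1, \<mu>2}. ?m \<mu>)"
  proof (cases "\<mu>1 = \<mu>2")
    case True
    have "{v1, v2} \<subseteq> eigenspace A \<mu>1" using v1 v2 True by (simp add: eigenspace_def)
    then have "card {v1, v2} \<le> dim (eigenspace A \<mu>1)"
      by (rule independent_card_le_dim[OF _ ind])
    then show ?thesis using v12 True by (simp add: eigenvalue_multiplicity_def)
  next
    case False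
    have "1 \<le> dim (eigenspace A \<mu>)" if "A *v v = \<mu> *\<^sub>R v" "norm v = 1" for v \<mu>
    proof -
      have "v \<noteq> 0" using that by auto
      then show ?thesis
        using independent_card_le_dim[of "{v}" "eigenspace A \<mu>"] that(1)
        by (simp add: eigenspace_def)
    qed
    then have "1 \<le> ?m \<mu>1" "1 \<le> ?m \<mu>2"
      unfolding eigenvalue_multiplicity_def using v1 v2 by blast+
    then show ?thesis using False by simp
  qed
  also have "\<dots> \<le> (\<Sum>\<mu>\<in>{\<mu>\<in>?E. ?P \<mu>}. ?m \<mu>)"
    by (rule sum_mono2) (use fin mem gt in auto)
  also have "\<dots> = length (filter ?P (rev ?L))"
    unfolding eigenvalue_list_def
    by (simp add: length_filter_concat_replicate fin)
  finally have 2: "2 \<le> length (filter ?P ?L)" by (simp add: rev_filter[symmetric])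
  \<comment> \<open>In a non-increasing list with two entries above \<open>\<theta>\<close>, the
    entry at position 1 is above \<open>\<theta>\<close>.\<close>
  have "sorted_wrt (\<ge>) ?L"
    unfolding eigenvalue_list_def sorted_wrt_rev by (simp add: sorted_concat_replicate)
  moreover have "2 \<le> length ?L" using 2 length_filter_le[of ?P ?L] by linarith
  then obtain c d R where L: "?L = c # d # R"
    by (auto simp: numeral_2_eq_2 Suc_le_length_iff)
  ultimately have R: "x \<le> d" if "x \<in> set R" for x using that by auto
  show ?thesis
  proof (rule ccontr)
    assume "\<not> ?thesis"
    then have d: "d \<le> \<theta>" by (simp add: L)
    then have "filter ?P R = []" using R by (force simp: filter_empty_conv)
    then show False using 2 d by (simp add: L split: if_splits)
  qed
qed

lemma restrict_matrix_quadratic_form: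
  "x \<bullet> (restrict_matrix A S *v x)
    = (\<chi> i. if i \<in> S then x$i else 0) \<bullet> (A *v (\<chi> i. if i \<in> S then x$i else 0))"
proof -
  have "(\<Sum>j\<in>S. A$i$j * x$j) = (\<Sum>j\<in>UNIV. A$i$j * (if j \<in> S then x$j else 0))" for i
    by (rule sum.mono_neutral_cong_left) auto
  then show ?thesis
    unfolding inner_vec_def restrict_matrix_mult_nth
    by (intro sum.cong) (auto simp: matrix_vector_mult_def)
qed

text \<open>Truncating \<open>x1\<close> to \<open>U1\<close> and \<open>x2\<close> to
  \<open>U2\<close> keeps the forms and shrinks the norms. The truncations are orthogonal with no
  edge between them, so norms and forms add over the plane they span.\<close>

lemma second_eigenvalue_greater_of_separated:
  fixes A :: "real^'n^'n"
  assumes sym: "transpose A = A" and \<theta>: "0 \<le> \<theta>" and disj: "U1 \<inter> U2 = {}"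
    and sep: "\<And>u v. u \<in> U1 \<Longrightarrow> v \<in> U2 \<Longrightarrow> A$u$v = 0"
    and x1: "\<theta> * (norm x1)\<^sup>2 < x1 \<bullet> (restrict_matrix A U1 *v x1)"
    and x2: "\<theta> * (norm x2)\<^sup>2 < x2 \<bullet> (restrict_matrix A U2 *v x2)"
  shows "\<theta> < eigenvalue_list A ! 1"
proof (rule second_eigenvalue_greater[OF sym])
  define y1 where "y1 = (\<chi> i. if i \<in> U1 then x1$i else 0)"
  define y2 where "y2 = (\<chi> i. if i \<in> U2 then x2$i else 0)"
  have "norm y1 \<le> norm x1" "norm y2 \<le> norm x2"
    by (auto intro!: norm_le_componentwise_cart simp: y1_def y2_def)
  then have "\<theta> * (norm y1)\<^sup>2 \<le> \<theta> * (norm x1)\<^sup>2" "\<theta> * (norm y2)\<^sup>2 \<le> \<theta> * (norm x2)\<^sup>2"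
    using \<theta> by (auto intro!: mult_left_mono power_mono)
  then have q1: "\<theta> * (norm y1)\<^sup>2 < y1 \<bullet> (A *v y1)" and q2: "\<theta> * (norm y2)\<^sup>2 < y2 \<bullet> (A *v y2)"
    using x1 x2 by (simp_all add: restrict_matrix_quadratic_form y1_def y2_def)
  have y12: "y1 \<bullet> y2 = 0"
    unfolding inner_vec_def using disj by (intro sum.neutral) (auto simp: y1_def y2_def)
  have Ay12: "y1 \<bullet> (A *v y2) = 0"
    unfolding inner_vec_def matrix_vector_mult_def
    by (intro sum.neutral) (auto simp: y1_def y2_def sep intro!: sum.neutral)
  show "\<theta> * (norm (a *\<^sub>R y1 + b *\<^sub>R y2))\<^sup>2
      < (a *\<^sub>R y1 + b *\<^sub>R y2) \<bullet> (A *v (a *\<^sub>R y1 + b *\<^sub>R y2))" if "a \<noteq> 0 \<or> b \<noteq> 0" for a b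
  proof -
    have n: "(norm (a *\<^sub>R y1 + b *\<^sub>R y2))\<^sup>2 = a\<^sup>2 * (norm y1)\<^sup>2 + b\<^sup>2 * (norm y2)\<^sup>2"
      unfolding power2_norm_eq_inner using y12
      by (simp add: algebra_simps inner_commute power2_eq_square)
    have q: "(a *\<^sub>R y1 + b *\<^sub>R y2) \<bullet> (A *v (a *\<^sub>R y1 + b *\<^sub>R y2))
        = a\<^sup>2 * (y1 \<bullet> (A *v y1)) + b\<^sup>2 * (y2 \<bullet> (A *v y2))"
      using Ay12 inner_mult_symmetric[OF sym, of y2 y1]
      by (simp add: algebra_simps inner_commute power2_eq_square)
    have "\<theta> * (a\<^sup>2 * (norm y1)\<^sup>2 + b\<^sup>2 * (norm y2)\<^sup>2)
        = a\<^sup>2 * (\<theta> * (norm y1)\<^sup>2) + b\<^sup>2 * (\<theta> * (norm y2)\<^sup>2)"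
      by (simp add: algebra_simps)
    moreover have "a\<^sup>2 * (\<theta> * (norm y1)\<^sup>2) \<le> a\<^sup>2 * (y1 \<bullet> (A *v y1))"
      "b\<^sup>2 * (\<theta> * (norm y2)\<^sup>2) \<le> b\<^sup>2 * (y2 \<bullet> (A *v y2))"
      using q1 q2 by (auto intro!: mult_left_mono)
    moreover have "a\<^sup>2 * (\<theta> * (norm y1)\<^sup>2) < a\<^sup>2 * (y1 \<bullet> (A *v y1))
      \<or> b\<^sup>2 * (\<theta> * (norm y2)\<^sup>2) < b\<^sup>2 * (y2 \<bullet> (A *v y2))"
      using q1 q2 that by auto
    ultimately show ?thesis unfolding n q by linarith
  qed
qed

section \<open>Eigenspaces after deletion of coordinates\<close>

lemma dim_vanishing:
  fixes S :: "'n::finite set"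
  shows "dim {x :: real^'n. \<forall>i\<in>S. x$i = 0} = CARD('n) - card S"
proof -
  have "{x :: real^'n. \<forall>i\<in>S. x$i = 0} = {x. \<forall>i. i \<notin> - S \<longrightarrow> x$i = 0}" by auto
  then show ?thesis
    using dim_substandard_cart[of "- S"]
    by (simp add: dim_vec_eq[symmetric] Compl_eq_Diff_UNIV card_Diff_subset)
qed

text \<open>Vanishing on \<open>S\<close> defines a subspace of codimension \<open>card S\<close>,
  and intersecting with it costs at most that much dimension.\<close>

lemma eigenvalue_multiplicity_le:
  fixes A :: "real^'n^'n"
  shows "eigenvalue_multiplicity A \<mu> \<le> card S + dim {x \<in> eigenspace A \<mu>. \<forall>i\<in>S. x$i = 0}"
proof -
  let ?E = "eigenspace A \<mu>" and ?T = "{x :: real^'n. \<forall>i\<in>S. x$i = 0}"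
  have "subspace ?T" by (auto simp: subspace_def)
  then have "dim {x + y |x y. x \<in> ?E \<and> y \<in> ?T} + dim (?E \<inter> ?T) = dim ?E + dim ?T"
    by (rule dim_sums_Int[OF subspace_eigenspace])
  moreover have "dim {x + y |x y. x \<in> ?E \<and> y \<in> ?T} \<le> CARD('n)"
    using dim_subset_UNIV[of "{x + y |x y. x \<in> ?E \<and> y \<in> ?T}"] by simp
  moreover have "card S \<le> CARD('n)" by (simp add: card_mono)
  moreover have "?E \<inter> ?T = {x \<in> ?E. \<forall>i\<in>S. x$i = 0}" by auto
  ultimately show ?thesis by (simp add: dim_vanishing eigenvalue_multiplicity_def)
qed

text \<open>
  The trace bound for the \<open>2s\<close>-th power of the matrix with the rows and columns in \<open>S\<close> deleted,
  in the form of Bessel's inequality applied to each of its columns.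
\<close>

lemma dim_vanishing_eigenspace_le:
  fixes A :: "real^'n^'n"
  assumes sym: "transpose A = A"
  shows "real (dim {x \<in> eigenspace A \<theta>. \<forall>i\<in>S. x$i = 0}) * \<theta> ^ (2 * s)
    \<le> (\<Sum>v\<in>UNIV. (norm (matrix_iterate (restrict_matrix A (- S)) s (axis v 1)))\<^sup>2)"
proof -
  let ?F = "{x \<in> eigenspace A \<theta>. \<forall>i\<in>S. x$i = 0}" and ?M = "restrict_matrix A (- S)"
  have F: "subspace ?F"
    using subspace_eigenspace[of A \<theta>] by (auto simp: subspace_def)
  obtain B where B: "B \<subseteq> ?F" "pairwise orthogonal B" "\<forall>b\<in>B. norm b = 1"
    "independent B" "card B = dim ?F"
  proof (rule orthonormal_basis_subspace[OF F])
    fix B assume "B \<subseteq> ?F" "pairwise orthogonal B" "\<And>b. b \<in> B \<Longrightarrow> norm b = 1"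
      "independent B" "card B = dim ?F"
    then show thesis by (intro that[of B] ballI)
  qed
  have finB: "finite B" using B(4) by (rule independent_imp_finite)
  \<comment> \<open>Deletion does not affect \<open>b\<close>: the removed columns meet zero
    entries, and in the removed rows both sides vanish.\<close>
  have ev: "?M *v b = \<theta> *\<^sub>R b" if "b \<in> B" for b
  proof -
    have b: "A *v b = \<theta> *\<^sub>R b" "\<forall>i\<in>S. b$i = 0" using that B(1) by (auto simp: eigenspace_def)
    have "(\<Sum>j\<in>-S. A$i$j * b$j) = (A *v b)$i" for i
      unfolding matrix_vector_mult_def using b(2)
      by (auto intro!: sum.mono_neutral_left)
    then show ?thesis using b by (auto simp: vec_eq_iff restrict_matrix_mult_nth)
  qed
  have "real (dim ?F) * \<theta> ^ (2 * s) = (\<Sum>b\<in>B. \<theta> ^ (2 * s) * (norm b)\<^sup>2)"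
    using B(3) by (simp add: B(5))
  also have "\<dots> = (\<Sum>b\<in>B. \<Sum>v\<in>UNIV. \<theta> ^ (2 * s) * (b$v)\<^sup>2)"
    by (simp add: norm_vec_squared sum_distrib_left)
  also have "\<dots> = (\<Sum>v\<in>UNIV. \<Sum>b\<in>B. \<theta> ^ (2 * s) * (b$v)\<^sup>2)" by (rule sum.swap)
  also have "\<dots> = (\<Sum>v\<in>UNIV. \<Sum>b\<in>B. (b \<bullet> matrix_iterate ?M s (axis v 1))\<^sup>2)"
  proof (intro sum.cong refl)
    fix v b assume "b \<in> B"
    have "b \<bullet> matrix_iterate ?M s (axis v 1) = \<theta> ^ s * b$v"
      unfolding inner_matrix_iterate[OF restrict_matrix_symmetric[OF sym]]
        matrix_iterate_eigenvector[OF ev[OF \<open>b \<in> B\<close>]]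
      by (simp add: inner_axis)
    then show "\<theta> ^ (2 * s) * (b$v)\<^sup>2 = (b \<bullet> matrix_iterate ?M s (axis v 1))\<^sup>2"
      by (simp only: power_mult_distrib power_mult mult.commute[of 2 s])
  qed
  also have "\<dots> \<le> (\<Sum>v\<in>UNIV. (norm (matrix_iterate ?M s (axis v 1)))\<^sup>2)"
    by (intro sum_mono bessel_inequality finB B(2)) (use B(3) in simp)
  finally show ?thesis .
qed

text \<open>An eigenvalue is at most the largest row sum. This supplies a vertex to which the ball
  hypothesis applies.\<close>

lemma eigenvalue_exceeds_degree_bound:
  fixes A :: "real^'n^'n"
  assumes sym: "transpose A = A" and nonneg: "\<And>i j. 0 \<le> A$i$j"
    and m: "eigenvalue_multiplicity A \<theta> \<noteq> 0" and c: "c < \<theta>"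
  shows "\<exists>v. c < (\<Sum>u\<in>UNIV. A$v$u)"
proof (rule ccontr)
  assume "\<not> ?thesis"
  then have row: "(\<Sum>u\<in>UNIV. A$v$u) \<le> c" for v by (simp add: not_less)
  obtain x where x: "x \<in> eigenspace A \<theta>" "x \<noteq> 0"
    using m unfolding eigenvalue_multiplicity_def dim_eq_0 by auto
  have "\<theta> * (norm x)\<^sup>2 = x \<bullet> (A *v x)"
    using x(1) by (simp add: eigenspace_def power2_norm_eq_inner)
  also have "\<dots> \<le> c * (norm x)\<^sup>2" by (rule quadratic_form_le_row_sum[OF sym nonneg row])
  finally show False using c x(2) by simp
qed

section \<open>Balls\<close>

text \<open>For an adjacency matrix, the vertices reachable by a walk of length at most
  \<open>k\<close>. The recursion extends walks at their far end.\<close>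

fun vertex_ball :: "real^'n^'n \<Rightarrow> nat \<Rightarrow> 'n \<Rightarrow> 'n set" where
  "vertex_ball A 0 v = {v}"
| "vertex_ball A (Suc k) v = vertex_ball A k v \<union> {u. \<exists>w\<in>vertex_ball A k v. A$w$u = 1}"

lemma vertex_ball_mono: "k \<le> l \<Longrightarrow> vertex_ball A k v \<subseteq> vertex_ball A l v"
  by (induction l) (auto simp: le_Suc_eq)

lemma vertex_ball_trans:
  "u \<in> vertex_ball A k v \<Longrightarrow> w \<in> vertex_ball A l u \<Longrightarrow> w \<in> vertex_ball A (k + l) v"
  by (induction l arbitrary: w) auto

lemma vertex_ball_edge: "A$v$u = 1 \<Longrightarrow> u \<in> vertex_ball A 1 v"
  by simp

lemma vertex_ball_sym:
  assumes "transpose A = A"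
  shows "u \<in> vertex_ball A k v \<Longrightarrow> v \<in> vertex_ball A k u"
proof (induction k arbitrary: u)
  case (Suc k)
  then consider "u \<in> vertex_ball A k v" | w where "w \<in> vertex_ball A k v" "A$w$u = 1" by auto
  then show ?case
  proof cases
    case 1
    then show ?thesis using Suc.IH by simp
  next
    case 2
    then have "A$u$w = 1" using symmetric_matrix_nth[OF assms] by metis
    then show ?thesis
      using vertex_ball_trans[OF vertex_ball_edge Suc.IH[OF 2(1)]] by simp
  qed
qed simp

text \<open>Splits off the first step of a walk, as the recursion of \<open>near\<close> does,
  whereas \<open>vertex_ball\<close> splits off the last.\<close>

lemma vertex_ball_Suc_first_step:
  "w \<in> vertex_ball A (Suc k) v
    \<Longrightarrow> w \<in> vertex_ball A k v \<or> (\<exists>u. A$v$u = 1 \<and> w \<in> vertex_ball A k u)"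
proof (induction k arbitrary: w)
  case (Suc k)
  then consider "w \<in> vertex_ball A (Suc k) v"
    | w' where "w' \<in> vertex_ball A (Suc k) v" "A$w'$w = 1" by auto
  then show ?case
  proof cases
    case 2
    then show ?thesis using Suc.IH[OF 2(1)] by auto
  qed simp
qed auto

lemma card_vertex_ball_le:
  assumes deg: "\<And>v. card {u. A$v$u = 1} \<le> D"
  shows "card (vertex_ball A k v) \<le> (1 + D) ^ k"
proof (induction k)
  case (Suc k)
  let ?N = "vertex_ball A k v"
  have "vertex_ball A (Suc k) v = ?N \<union> (\<Union>w\<in>?N. {u. A$w$u = 1})" by auto
  then have "card (vertex_ball A (Suc k) v) \<le> card ?N + card (\<Union>w\<in>?N. {u. A$w$u = 1})"
    by (simp add: card_Un_le)
  also have "card (\<Union>w\<in>?N. {u. A$w$u = 1}) \<le> (\<Sum>w\<in>?N. card {u. A$w$u = 1})"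
    by (rule card_UN_le) simp
  also have "\<dots> \<le> card ?N * D" using sum_bounded_above[of ?N _ D] deg by simp
  finally have "card (vertex_ball A (Suc k) v) \<le> (1 + D) * card ?N" by (simp add: algebra_simps)
  also have "\<dots> \<le> (1 + D) * (1 + D) ^ k" using Suc by (rule mult_left_mono) simp
  finally show ?case by simp
qed simp

text \<open>In a graph of maximum degree at most 1, a ball is a vertex with at most one neighbour.
  Hence \<open>B > 2\<close> will force a vertex of degree 2.\<close>

lemma card_vertex_ball_le_2:
  assumes sym: "transpose A = A" and deg: "\<And>v. card {u. A$v$u = 1} \<le> 1"
  shows "card (vertex_ball A k v) \<le> 2"
proof -
  have uniq: "u = w" if "A$x$u = 1" "A$x$w = 1" for x u w
    using deg[of x] that by (auto simp: card_le_Suc0_iff_eq)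
  have "vertex_ball A k v \<subseteq> insert v {u. A$v$u = 1}"
  proof (induction k)
    case (Suc k)
    have "u \<in> insert v {u. A$v$u = 1}" if "w \<in> insert v {u. A$v$u = 1}" "A$w$u = 1" for u w
      using that uniq[of w u v] symmetric_matrix_nth[OF sym, of v w] by auto
    then show ?case using Suc by auto
  qed simp
  then have "card (vertex_ball A k v) \<le> card (insert v {u. A$v$u = 1})"
    by (intro card_mono) auto
  also have "\<dots> \<le> 2" using deg[of v] by (simp add: card_insert_if)
  finally show ?thesis .
qed

lemma near_mono: "near A U W k \<subseteq> near A U W (Suc k)"
  by (induction k) auto

text \<open>A walk of length at most \<open>k\<close> from \<open>v\<close> to \<open>w\<close>
  stays in the ball, hence in \<open>U\<close>, and it must leave \<open>W\<close> on the
  way.\<close>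

lemma mem_near:
  assumes "v \<in> W" "vertex_ball A k v \<subseteq> U" "w \<in> vertex_ball A k v" "w \<notin> W"
  shows "v \<in> near A U W k"
  using assms
proof (induction k arbitrary: v)
  case (Suc k)
  from vertex_ball_Suc_first_step[OF Suc.prems(3)] show ?case
  proof (elim disjE exE conjE)
    assume "w \<in> vertex_ball A k v"
    then show ?thesis
      using Suc near_mono[of A U W k] by (simp del: near.simps) blast
  next
    fix u assume u: "A$v$u = 1" "w \<in> vertex_ball A k u"
    have "vertex_ball A k u \<subseteq> U"
      using vertex_ball_trans[OF vertex_ball_edge[OF u(1)]] Suc.prems(2) by fastforce
    moreover have "u \<in> U"
      using vertex_ball_edge[OF u(1)] vertex_ball_mono[of 1 "Suc k" A v] Suc.prems(2) by auto
    ultimately have "u \<in> near A U W k \<union> (U - W)" using Suc.IH[of u] u Suc.prems(4) by blast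
    then show ?thesis using u Suc.prems(1) by auto
  qed
qed simp

text \<open>After \<open>j\<close> steps from \<open>v\<close> the vector lives on the ball of
  radius \<open>j\<close>, so up to step \<open>s\<close> nothing outside the ball of radius
  \<open>s\<close> is seen. The support claim is proved jointly because the induction for the
  equality uses it.\<close>

lemma matrix_iterate_axis_local:
  fixes A :: "real^'n^'n"
  assumes A01: "\<And>i j. A$i$j \<in> {0, 1}" and sym: "transpose A = A" and "j \<le> s"
  shows "matrix_iterate (restrict_matrix A H) j (axis v 1)
      = matrix_iterate (restrict_matrix A (vertex_ball A s v \<inter> H)) j (axis v 1)
    \<and> (\<forall>i. i \<notin> vertex_ball A j v \<longrightarrow> matrix_iterate (restrict_matrix A H) j (axis v 1) $ i = 0)"
  using assms(3)
proof (induction j)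
  case 0
  then show ?case by (simp add: axis_def)
next
  case (Suc j)
  let ?W = "vertex_ball A s v \<inter> H"
  define y where "y = matrix_iterate (restrict_matrix A H) j (axis v 1)"
  have eq: "matrix_iterate (restrict_matrix A ?W) j (axis v 1) = y"
    and supp: "\<And>i. i \<notin> vertex_ball A j v \<Longrightarrow> y$i = 0"
    using Suc by (auto simp: y_def)
  have sub: "vertex_ball A j v \<subseteq> vertex_ball A s v" "vertex_ball A (Suc j) v \<subseteq> vertex_ball A s v"
    using Suc.prems by (intro vertex_ball_mono; simp)+
  have zero: "A$i$l * y$l = 0" if "i \<notin> vertex_ball A (Suc j) v" for i l
  proof (cases "l \<in> vertex_ball A j v")
    case True
    then have "A$l$i \<noteq> 1" using that by auto
    then show ?thesis using A01[of l i] symmetric_matrix_nth[OF sym, of i l] by auto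
  qed (simp add: supp)
  have supp': "(restrict_matrix A H *v y)$i = 0" if "i \<notin> vertex_ball A (Suc j) v" for i
    unfolding restrict_matrix_mult_nth by (simp add: zero[OF that])
  have "restrict_matrix A H *v y = restrict_matrix A ?W *v y"
  proof (rule vec_eq_iff[THEN iffD2], rule allI)
    fix i
    have "(\<Sum>l\<in>H. A$i$l * y$l) = (\<Sum>l\<in>?W. A$i$l * y$l)"
      using sub(1) supp by (intro sum.mono_neutral_right) auto
    moreover have "(\<Sum>l\<in>H. A$i$l * y$l) = 0" if "i \<notin> vertex_ball A s v"
    proof -
      have "i \<notin> vertex_ball A (Suc j) v" using that sub(2) by blast
      then show ?thesis by (simp add: zero)
    qed
    ultimately show "(restrict_matrix A H *v y)$i = (restrict_matrix A ?W *v y)$i"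
      unfolding restrict_matrix_mult_nth by auto
  qed
  then show ?case using supp' eq by (simp add: y_def)
qed

lemma matrix_iterate_mult_bound:
  assumes "\<And>y. (norm (matrix_iterate M k y))\<^sup>2 \<le> c * (norm y)\<^sup>2" and "0 \<le> c"
  shows "(norm (matrix_iterate M (k * t) y))\<^sup>2 \<le> c ^ t * (norm y)\<^sup>2"
proof (induction t)
  case (Suc t)
  have "matrix_iterate M (k * Suc t) y = matrix_iterate M k (matrix_iterate M (k * t) y)"
    by (simp add: funpow_add)
  then have "(norm (matrix_iterate M (k * Suc t) y))\<^sup>2 \<le> c * (norm (matrix_iterate M (k * t) y))\<^sup>2"
    using assms(1) by simp
  also have "\<dots> \<le> c * (c ^ t * (norm y)\<^sup>2)" using Suc assms(2) by (rule mult_left_mono)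
  finally show ?case by (simp add: mult_ac)
qed simp

section \<open>The deleted vertices and the multiplicity bound\<close>

lemma maximal_ball_packing:
  fixes A :: "real^'n^'n"
  shows "\<exists>P\<subseteq>X. pairwise (\<lambda>u v. vertex_ball A r u \<inter> vertex_ball A r v = {}) P
    \<and> (\<forall>v\<in>X. \<exists>p\<in>P. vertex_ball A r v \<inter> vertex_ball A r p \<noteq> {})"
proof -
  define F where "F = {P. P \<subseteq> X \<and> pairwise (\<lambda>u v. vertex_ball A r u \<inter> vertex_ball A r v = {}) P}"
  have "finite F" "{} \<in> F" by (auto simp: F_def)
  then obtain P where P: "P \<in> F" "\<And>Q. Q \<in> F \<Longrightarrow> P \<subseteq> Q \<Longrightarrow> Q = P"
    using finite_has_maximal[of F] by blast
  show ?thesis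
  proof (intro exI[of _ P] conjI ballI)
    show "P \<subseteq> X" "pairwise (\<lambda>u v. vertex_ball A r u \<inter> vertex_ball A r v = {}) P"
      using P(1) by (simp_all add: F_def)
    show "\<exists>p\<in>P. vertex_ball A r v \<inter> vertex_ball A r p \<noteq> {}" if "v \<in> X" for v
    proof (rule ccontr)
      assume far: "\<not> (\<exists>p\<in>P. vertex_ball A r v \<inter> vertex_ball A r p \<noteq> {})"
      then have "insert v P \<in> F"
        using P(1) that by (auto simp: F_def pairwise_insert Int_commute)
      \<comment> \<open>Maximality puts \<open>v\<close> itself into \<open>P\<close>, but its ball
        contains \<open>v\<close> and so meets itself.\<close>
      then have "v \<in> P" using P(2) by blast
      moreover have "v \<in> vertex_ball A r v" using vertex_ball_mono[of 0 r A v] by simp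
      ultimately show False using far by blast
    qed
  qed
qed

lemma card_ball_packing_le:
  fixes A :: "real^'n^'n"
  assumes "pairwise (\<lambda>u v. vertex_ball A r u \<inter> vertex_ball A r v = {}) P"
    and "\<And>v. v \<in> P \<Longrightarrow> B \<le> real (card (vertex_ball A r v))"
  shows "real (card P) * B \<le> real CARD('n)"
proof -
  have "real (card P) * B \<le> (\<Sum>v\<in>P. real (card (vertex_ball A r v)))"
    by (rule sum_bounded_below) (rule assms(2))
  also have "\<dots> = real (card (\<Union>v\<in>P. vertex_ball A r v))"
    using assms(1) by (subst card_UN_disjoint) (auto simp: pairwise_def)
  also have "\<dots> \<le> real CARD('n)" by (simp add: card_mono)
  finally show ?thesis .
qed

text \<open>Two exceptional vertices more than \<open>2 * R + 1\<close> apart have disjoint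
  \<open>R\<close>-balls with no edge between them, which would push the second eigenvalue above
  \<open>\<theta>\<close>. So one ball of radius \<open>2 * R + 1\<close> contains them all.\<close>

lemma card_exceptional_le:
  fixes A :: "real^'n^'n"
  assumes sym: "transpose A = A" and A01: "\<And>i j. A$i$j \<in> {0, 1}"
    and deg: "\<And>v. card {u. A$v$u = 1} \<le> D" and \<theta>: "0 \<le> \<theta>" "eigenvalue_list A ! 1 \<le> \<theta>"
  shows "card {v. \<exists>x. \<theta> * (norm x)\<^sup>2 < x \<bullet> (restrict_matrix A (vertex_ball A R v) *v x)}
    \<le> (1 + D) ^ (2 * R + 1)" (is "card ?X \<le> _")
proof (cases "?X = {}")
  case False
  then obtain v0 where v0: "v0 \<in> ?X" by blast
  have "?X \<subseteq> vertex_ball A (2 * R + 1) v0"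
  proof
    fix v assume v: "v \<in> ?X"
    show "v \<in> vertex_ball A (2 * R + 1) v0"
    proof (rule ccontr)
      assume far: "v \<notin> vertex_ball A (2 * R + 1) v0"
      have "vertex_ball A R v0 \<inter> vertex_ball A R v = {}"
      proof (rule ccontr)
        assume "\<not> ?thesis"
        then obtain u where "u \<in> vertex_ball A R v0" "u \<in> vertex_ball A R v" by blast
        then have "v \<in> vertex_ball A (R + R) v0"
          using vertex_ball_trans vertex_ball_sym[OF sym] by blast
        then show False using far by (simp add: mult_2)
      qed
      moreover have "A$u$w = 0" if "u \<in> vertex_ball A R v0" "w \<in> vertex_ball A R v" for u w
      proof (rule ccontr)
        assume "A$u$w \<noteq> 0"
        then have "A$u$w = 1" using A01[of u w] by auto
        then have "w \<in> vertex_ball A (R + 1) v0"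
          using vertex_ball_trans[OF that(1) vertex_ball_edge] by blast
        then have "v \<in> vertex_ball A (R + 1 + R) v0"
          using vertex_ball_trans vertex_ball_sym[OF sym that(2)] by blast
        moreover have "R + 1 + R = 2 * R + 1" by simp
        ultimately show False using far by metis
      qed
      moreover obtain x0 x where "\<theta> * (norm x0)\<^sup>2 < x0 \<bullet> (restrict_matrix A (vertex_ball A R v0) *v x0)"
        "\<theta> * (norm x)\<^sup>2 < x \<bullet> (restrict_matrix A (vertex_ball A R v) *v x)"
        using v v0 by blast
      ultimately have "\<theta> < eigenvalue_list A ! 1"
        by (rule second_eigenvalue_greater_of_separated[OF sym \<theta>(1)])
      then show False using \<theta>(2) by simp
    qed
  qed
  then have "card ?X \<le> card (vertex_ball A (2 * R + 1) v0)" by (intro card_mono) auto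
  also have "\<dots> \<le> (1 + D) ^ (2 * R + 1)" by (rule card_vertex_ball_le[OF deg])
  finally show ?thesis .
qed simp

text \<open>The summands account for the packing \<open>P\<close>, the exceptional set
  \<open>X\<close>, and the eigenvectors vanishing on both. The number \<open>t\<close> of blocks of
  \<open>2 * r\<close> steps stays free.\<close>

lemma eigenvalue_multiplicity_bound:
  fixes A :: "real^'n^'n"
  assumes sym: "transpose A = A" and A01: "\<And>i j. A$i$j \<in> {0, 1}"
    and deg: "\<And>v. card {u. A$v$u = 1} \<le> D"
    and \<theta>: "1 \<le> \<theta>" "eigenvalue_list A ! 1 \<le> \<theta>" and B: "0 < B"
    and ball: "\<And>v. \<theta> - 1 < (\<Sum>u\<in>UNIV. A$v$u) \<Longrightarrow> B \<le> real (card (vertex_ball A r v))"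
    and r: "1 \<le> r" and t: "1 \<le> t"
  shows "real (eigenvalue_multiplicity A \<theta>) \<le> real CARD('n) / B
    + real ((1 + D) ^ (2 * (2 * r * t + 2 * r) + 1))
    + real CARD('n) * (1 - 1 / (2 * \<theta> ^ (4 * r + 1))) ^ t"
proof -
  define k where "k = 2 * r"
  define s where "s = k * t"
  \<comment> \<open>Large enough for the ball around \<open>v\<close> to contain the
    \<open>k\<close>-ball of every vertex within \<open>s\<close> of \<open>v\<close>.\<close>
  define R where "R = s + k"
  define c where "c = \<theta> ^ (2 * k) - 1 / (2 * \<theta>)"
  have k1: "1 \<le> k" and s1: "1 \<le> s" using r t by (auto simp: k_def s_def)
  obtain P where P: "P \<subseteq> {v. \<theta> - 1 < (\<Sum>u\<in>UNIV. A$v$u)}"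
    "pairwise (\<lambda>u v. vertex_ball A r u \<inter> vertex_ball A r v = {}) P"
    "\<And>v. \<theta> - 1 < (\<Sum>u\<in>UNIV. A$v$u) \<Longrightarrow> \<exists>p\<in>P. vertex_ball A r v \<inter> vertex_ball A r p \<noteq> {}"
    using maximal_ball_packing[of "{v. \<theta> - 1 < (\<Sum>u\<in>UNIV. A$v$u)}" A r] by auto
  have "real (card P) * B \<le> real CARD('n)"
    by (rule card_ball_packing_le[OF P(2)]) (use P(1) ball in auto)
  then have cardP: "real (card P) \<le> real CARD('n) / B" using B by (simp add: field_simps)
  define X where "X = {v. \<exists>x. \<theta> * (norm x)\<^sup>2 < x \<bullet> (restrict_matrix A (vertex_ball A R v) *v x)}"
  have cardX: "card X \<le> (1 + D) ^ (2 * R + 1)"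
    unfolding X_def by (rule card_exceptional_le[OF sym A01 deg]) (use \<theta> in auto)
  define S where "S = P \<union> X"
  have c0: "0 \<le> c"
  proof -
    have "1 / (2 * \<theta>) \<le> 1" using \<theta> by (simp add: field_simps)
    also have "\<dots> \<le> \<theta> ^ (2 * k)" using \<theta>(1) by (rule one_le_power)
    finally show ?thesis by (simp add: c_def)
  qed
  have local: "(norm (matrix_iterate (restrict_matrix A (- S)) s (axis v 1)))\<^sup>2 \<le> c ^ t" for v
  proof (cases "v \<in> S")
    case True
    \<comment> \<open>A deleted vertex is killed in the first step, and
      \<open>s \<ge> 1\<close>.\<close>
    have "(restrict_matrix A (- S) *v axis v 1)$i = 0" for i
      unfolding restrict_matrix_mult_nth using True
      by (auto simp: axis_def intro!: sum.neutral)
    then have 0: "restrict_matrix A (- S) *v axis v 1 = 0 *\<^sub>R axis v 1" by (simp add: vec_eq_iff)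
    show ?thesis using s1 c0 by (simp add: matrix_iterate_eigenvector[OF 0] power_0_left)
  next
    case False
    let ?W = "vertex_ball A s v \<inter> - S" and ?U = "vertex_ball A R v"
    have WU: "?W \<subseteq> ?U" using vertex_ball_mono[of s R A v] by (auto simp: R_def)
    have "(norm (matrix_iterate (restrict_matrix A ?W) k y))\<^sup>2 \<le> c * (norm y)\<^sup>2" for y
      unfolding c_def
    proof (rule norm_restrict_matrix_iterate_le[OF sym A01 WU \<theta>(1) k1])
      \<comment> \<open>This is what \<open>v\<close> lying outside \<open>X\<close> means.\<close>
      show "x \<bullet> (restrict_matrix A ?U *v x) \<le> \<theta> * (norm x)\<^sup>2" for x
        using False by (auto simp: S_def X_def not_less)
      fix w assume w: "w \<in> ?W - near A ?U ?W k"
      show "(\<Sum>u\<in>UNIV. A$w$u) \<le> \<theta> - 1"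
      proof (rule ccontr)
        assume "\<not> ?thesis"
        \<comment> \<open>If \<open>w\<close> had larger degree, its \<open>r\<close>-ball would
          meet that of some \<open>p\<close> in \<open>P\<close>. Then \<open>w\<close> is within
          \<open>k = 2 * r\<close> of the deleted vertex \<open>p\<close> and so belongs to
          \<open>near\<close>.\<close>
        then obtain p u where p: "p \<in> P" and u: "u \<in> vertex_ball A r w" "u \<in> vertex_ball A r p"
          using P(3)[of w] by fastforce
        have "p \<in> vertex_ball A k w"
          using vertex_ball_trans[OF u(1) vertex_ball_sym[OF sym u(2)]] by (simp add: k_def mult_2)
        moreover have "vertex_ball A k w \<subseteq> ?U"
          using w vertex_ball_trans[of w A s v _ k] by (auto simp: R_def)
        ultimately have "w \<in> near A ?U ?W k"
          using w p by (intro mem_near[of w ?W A k ?U p]) (auto simp: S_def)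
        then show False using w by simp
      qed
    qed
    then have "(norm (matrix_iterate (restrict_matrix A ?W) s (axis v 1)))\<^sup>2 \<le> c ^ t * (norm (axis v (1::real)))\<^sup>2"
      unfolding s_def by (rule matrix_iterate_mult_bound[OF _ c0])
    then show ?thesis
      using matrix_iterate_axis_local[OF A01 sym order_refl, where H="- S" and v=v] by (simp add: norm_axis_1)
  qed
  let ?d = "dim {x \<in> eigenspace A \<theta>. \<forall>i\<in>S. x$i = 0}"
  have "real ?d * \<theta> ^ (2 * s) \<le> real CARD('n) * c ^ t"
  proof -
    have "real ?d * \<theta> ^ (2 * s) \<le> (\<Sum>v\<in>UNIV. (norm (matrix_iterate (restrict_matrix A (- S)) s (axis v 1)))\<^sup>2)"
      by (rule dim_vanishing_eigenspace_le[OF sym])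
    also have "\<dots> \<le> (\<Sum>v\<in>(UNIV :: 'n set). c ^ t)" by (rule sum_mono) (rule local)
    finally show ?thesis by simp
  qed
  moreover have "\<theta> ^ (2 * s) = (\<theta> ^ (2 * k)) ^ t"
    by (simp add: s_def power_mult[symmetric] mult.assoc)
  moreover have "c = \<theta> ^ (2 * k) * (1 - 1 / (2 * \<theta> ^ (4 * r + 1)))"
    using \<theta> by (simp add: c_def k_def field_simps)
  ultimately have "real ?d * (\<theta> ^ (2 * k)) ^ t
      \<le> (real CARD('n) * (1 - 1 / (2 * \<theta> ^ (4 * r + 1))) ^ t) * (\<theta> ^ (2 * k)) ^ t"
    by (simp add: power_mult_distrib mult_ac)
  then have d: "real ?d \<le> real CARD('n) * (1 - 1 / (2 * \<theta> ^ (4 * r + 1))) ^ t"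
    using \<theta> by (simp add: mult_le_cancel_right)
  have "eigenvalue_multiplicity A \<theta> \<le> card S + ?d" by (rule eigenvalue_multiplicity_le)
  also have "card S \<le> card P + card X" unfolding S_def by (rule card_Un_le)
  finally have "real (eigenvalue_multiplicity A \<theta>) \<le> real (card P) + real (card X) + real ?d" by linarith
  moreover have "real (card X) \<le> real ((1 + D) ^ (2 * R + 1))" using cardX by (rule of_nat_mono)
  ultimately show ?thesis using d cardP by (simp add: R_def s_def k_def)
qed

text \<open>
  The number \<open>t\<close> is about \<open>6 \<theta>^(4r+1) log B\<close>, which brings the third summand below \<open>n / B^3\<close>; the second
  one is at most \<open>Y = \<Delta>^(2e)\<close> with \<open>B \<le> Y\<close> and \<open>Y^4 \<le> n\<close>.
\<close>

lemma parameter_choice: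
  fixes \<Delta> B \<theta> :: real and n r D :: nat
  assumes n: "1 \<le> n" and D: "2 \<le> D" "real D \<le> \<Delta>" and B: "2 < B" and \<theta>: "1 \<le> \<theta>" and r: "1 \<le> r"
    and H: "2 ^ 9 * real r * \<theta> ^ (4 * r + 2) * log 2 B \<le> log \<Delta> (real n)"
  shows "\<exists>t\<ge>1. real n / B + real ((1 + D) ^ (2 * (2 * r * t + 2 * r) + 1))
    + real n * (1 - 1 / (2 * \<theta> ^ (4 * r + 1))) ^ t \<le> real n / (B - 1)"
proof -
  define b where "b = log 2 B"
  define L where "L = \<theta> ^ (4 * r + 1)"
  define t where "t = nat \<lceil>6 * L * b\<rceil>"
  define e where "e = 2 * (2 * r * t + 2 * r) + 1"
  have b1: "1 < b" using B by (simp add: b_def less_log_iff)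
  have L1: "1 \<le> L" unfolding L_def using \<theta> by (rule one_le_power)
  have Lb: "1 < L * b" using mult_right_mono[OF L1, of b] b1 by linarith
  \<comment> \<open>Rounding up adds at most 1, which is below \<open>L * b\<close>.\<close>
  have t: "6 * (L * b) \<le> real t" "real t \<le> 7 * (L * b)"
    using Lb ceiling_correct[of "6 * L * b"] by (simp_all add: t_def mult.assoc)
  have t1: "1 \<le> t" using t(1) Lb by linarith
  have r1: "1 \<le> real r" using r by simp
  have rLb: "real r \<le> real r * (L * b)" "L * b \<le> real r * (L * b)"
    using r1 Lb by (simp_all add: mult_le_cancel_left1 mult_le_cancel_right1)
  have "real r * real t \<le> 7 * (real r * (L * b))"
    using mult_left_mono[OF t(2), of "real r"] by simp
  then have "real e \<le> 28 * (real r * (L * b)) + 4 * real r + 1" by (simp add: e_def algebra_simps)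
  \<comment> \<open>Since \<open>r\<close> and 1 are at most \<open>r * L * b\<close>, the sum is at
    most 33 times that product, and \<open>8 * 33 = 264\<close>.\<close>
  then have e: "8 * real e \<le> 512 * (real r * (L * b))" using rLb r1 by linarith
  have "L \<le> \<theta> ^ (4 * r + 2)" unfolding L_def using \<theta> by (intro power_increasing) auto
  then have "512 * (real r * (L * b)) \<le> 2 ^ 9 * real r * \<theta> ^ (4 * r + 2) * b"
    using b1 by (simp add: mult_left_mono mult_right_mono)
  also have "\<dots> \<le> log \<Delta> (real n)" using H by (simp add: b_def)
  finally have 8: "8 * real e \<le> log \<Delta> (real n)" using e by linarith
  have \<Delta>: "2 \<le> \<Delta>" using D by simp
  define Y where "Y = \<Delta> ^ (2 * e)"
  have "Y ^ 4 = \<Delta> ^ (8 * e)"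
    unfolding Y_def power_mult[symmetric] by (simp add: mult.commute)
  also have "\<dots> = \<Delta> powr real (8 * e)" using \<Delta> by (intro powr_realpow[symmetric]) auto
  also have "\<dots> \<le> \<Delta> powr (log \<Delta> (real n))" using 8 \<Delta> by (intro powr_mono) auto
  also have "\<dots> = real n" using \<Delta> n by simp
  finally have Y4: "Y ^ 4 \<le> real n" .
  \<comment> \<open>Here \<open>D \<ge> 2\<close> enters; the square explains the exponent
    \<open>2 * e\<close> of \<open>Y\<close>.\<close>
  have "1 + D \<le> D * D" using mult_le_mono2[OF D(1), of D] D(1) by linarith
  then have "real (1 + D) \<le> real (D * D)" by (rule of_nat_mono)
  also have "\<dots> = (real D)\<^sup>2" by (simp add: power2_eq_square)
  also have "\<dots> \<le> \<Delta>\<^sup>2" using D by (intro power_mono) auto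
  finally have "real (1 + D) ^ e \<le> (\<Delta>\<^sup>2) ^ e" by (intro power_mono) auto
  then have DY: "real ((1 + D) ^ e) \<le> Y" by (simp add: Y_def power_mult)
  have "b \<le> real (2 * e)"
  proof -
    have "b \<le> L * b" using L1 b1 by (simp add: mult_le_cancel_right1)
    also have "\<dots> \<le> real t" using t(1) Lb by linarith
    also have "\<dots> \<le> real (2 * e)"
    proof -
      have "t \<le> r * t" using r by simp
      moreover have "2 * e = 8 * (r * t) + 8 * r + 2" by (simp add: e_def)
      ultimately have "t \<le> 2 * e" by linarith
      then show ?thesis by (rule of_nat_mono)
    qed
    finally show ?thesis .
  qed
  then have "B \<le> 2 powr real (2 * e)" using B by (simp add: b_def log_le_iff)
  also have "\<dots> \<le> \<Delta> powr real (2 * e)" using \<Delta> by (intro powr_mono2) auto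
  also have "\<dots> = Y" using \<Delta> unfolding Y_def by (intro powr_realpow) auto
  finally have BY: "B \<le> Y" .
  \<comment> \<open>Of the four factors \<open>Y\<close> available in \<open>n\<close>, one covers
    the ball count and three cover \<open>B ^ 3\<close>.\<close>
  have "Y * B ^ 3 \<le> Y * Y ^ 3" using BY B by (intro mult_left_mono power_mono) auto
  also have "\<dots> = Y ^ 4" using power_Suc[of Y 3] by simp
  finally have "Y * B ^ 3 \<le> real n" using Y4 by linarith
  moreover have "real ((1 + D) ^ e) * B ^ 3 \<le> Y * B ^ 3"
    using DY B by (intro mult_right_mono) auto
  ultimately have "real ((1 + D) ^ e) * B ^ 3 \<le> real n" by linarith
  then have 1: "real ((1 + D) ^ e) \<le> real n / B ^ 3"
    using B by (subst pos_le_divide_eq) auto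
  have "(1 - 1 / (2 * L)) ^ t \<le> exp (- (1 / (2 * L))) ^ t"
  proof (rule power_mono)
    show "1 - 1 / (2 * L) \<le> exp (- (1 / (2 * L)))" using exp_ge_add_one_self[of "- (1 / (2 * L))"] by simp
    show "0 \<le> 1 - 1 / (2 * L)" using L1 by (simp add: field_simps)
  qed
  also have "\<dots> = exp (- (real t / (2 * L)))" by (simp add: exp_of_nat_mult[symmetric])
  \<comment> \<open>The factor 6 in \<open>t\<close> gives exponent \<open>3 * b\<close>, and the
    natural logarithm of \<open>B\<close> is at most \<open>b\<close>.\<close>
  also have "\<dots> \<le> exp (- (3 * ln B))"
  proof -
    have "ln B = b * ln 2" using B by (simp add: b_def log_def)
    also have "\<dots> \<le> b * 1" using b1 ln2_le_25_over_36 by (intro mult_left_mono) auto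
    also have "b * 1 \<le> real t / (6 * L)" using t(1) L1 by (simp add: pos_le_divide_eq mult_ac)
    finally have "3 * ln B \<le> 3 * (real t / (6 * L))" by simp
    also have "\<dots> = real t / (2 * L)" by simp
    finally show ?thesis by simp
  qed
  also have "\<dots> = 1 / B ^ 3"
    using B exp_of_nat_mult[of 3 "ln B"] by (simp add: exp_minus inverse_eq_divide)
  finally have "real n * (1 - 1 / (2 * L)) ^ t \<le> real n * (1 / B ^ 3)"
    by (rule mult_left_mono) simp
  then have 2: "real n * (1 - 1 / (2 * L)) ^ t \<le> real n / B ^ 3" by simp
  \<comment> \<open>Both error terms fit into the gap between \<open>1 / B\<close> and
    \<open>1 / (B - 1)\<close>.\<close>
  have "1 / B + 2 / B ^ 3 \<le> 1 / (B - 1)"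
  proof -
    have "(B\<^sup>2 + 2) * (B - 1) \<le> B ^ 3"
    proof -
      have "B ^ 3 - (B\<^sup>2 + 2) * (B - 1) = (B - 1)\<^sup>2 + 1" by (simp add: power2_eq_square power3_eq_cube algebra_simps)
      then show ?thesis using zero_le_power2[of "B - 1"] by linarith
    qed
    then have "(B\<^sup>2 + 2) / B ^ 3 \<le> 1 / (B - 1)" using B by (simp add: divide_simps)
    moreover have "(B\<^sup>2 + 2) / B ^ 3 = 1 / B + 2 / B ^ 3"
      using B by (simp add: field_simps power2_eq_square power3_eq_cube)
    ultimately show ?thesis by simp
  qed
  then have "real n * (1 / B + 2 / B ^ 3) \<le> real n * (1 / (B - 1))" by (rule mult_left_mono) simp
  then have "real n / B + real n / B ^ 3 + real n / B ^ 3 \<le> real n / (B - 1)"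
    by (simp add: algebra_simps)
  then show ?thesis using 1 2 t1 unfolding e_def L_def by (intro exI[of _ t]) linarith
qed

section \<open>Adjacency matrices of graphs\<close>

lemma adjacency_matrix_nth:
  "adjacency_matrix G $ u $ v = (if (u, v) \<in> arcs_ends G then 1 else 0)"
  by (simp add: adjacency_matrix_def)

lemma adjacency_matrix_01: "adjacency_matrix G $ u $ v \<in> {0, 1}"
  by (simp add: adjacency_matrix_nth)

lemma adjacency_matrix_symmetric:
  assumes "graph G"
  shows "transpose (adjacency_matrix G) = adjacency_matrix G"
proof -
  interpret graph G by (rule assms)
  have "sym (arcs_ends G)" using sym_arcs by (simp add: symmetric_def)
  then show ?thesis
    by (auto simp: transpose_def adjacency_matrix_def vec_eq_iff dest: symD)
qed

text \<open>The degree counts arcs; without parallel arcs \<open>head\<close> is injective on those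
  leaving \<open>v\<close>.\<close>

lemma out_degree_eq_card:
  fixes G :: "('v::finite, 'e) pre_digraph"
  assumes "graph G"
  shows "out_degree G v = card {u. adjacency_matrix G $ v $ u = 1}"
proof -
  interpret graph G by (rule assms)
  have "inj_on (head G) (out_arcs G v)"
    by (intro inj_onI no_multi_arcs) (auto simp: arc_to_ends_def)
  moreover have "head G ` out_arcs G v = {u. adjacency_matrix G $ v $ u = 1}"
    by (auto simp: adjacency_matrix_nth arcs_ends_def arc_to_ends_def image_iff)
  ultimately show ?thesis
    unfolding out_degree_def by (metis card_image)
qed

lemma row_sum_adjacency_matrix:
  fixes G :: "('v::finite, 'e) pre_digraph"
  assumes "graph G"
  shows "(\<Sum>u\<in>UNIV. adjacency_matrix G $ v $ u) = real (out_degree G v)"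
proof -
  have "(\<Sum>u\<in>UNIV. adjacency_matrix G $ v $ u) = (\<Sum>u\<in>{u. adjacency_matrix G $ v $ u = 1}. 1)"
    by (rule sum.mono_neutral_cong_right) (auto simp: adjacency_matrix_nth)
  then show ?thesis by (simp add: out_degree_eq_card[OF assms])
qed

text \<open>Transfers the lower bound on ball sizes to the matrix setting. With unit weights the
  cost of a walk is its length, so a distance of at most \<open>r\<close> yields a walk of at most
  \<open>r\<close> arcs.\<close>

lemma graph_ball_subset_vertex_ball:
  fixes G :: "('v::finite, 'e) pre_digraph"
  assumes "graph G"
  shows "verts (graph_ball G r v) \<subseteq> vertex_ball (adjacency_matrix G) r v"
proof
  interpret graph G by (rule assms)
  have walk: "u \<in> vertex_ball (adjacency_matrix G) (length p) v" if "awalk v p u" for v p u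
    using that
  proof (induction p arbitrary: v)
    case Nil
    then show ?case by (simp add: awalk_Nil_iff)
  next
    case (Cons e p)
    then have e: "e \<in> arcs G" "v = tail G e" "awalk (head G e) p u" by (simp_all add: awalk_Cons_iff)
    then have "adjacency_matrix G $ v $ head G e = 1"
      by (auto simp: adjacency_matrix_nth arcs_ends_def arc_to_ends_def)
    from vertex_ball_trans[OF vertex_ball_edge[OF this] Cons.IH[OF e(3)]]
    show ?case by simp
  qed
  fix u assume "u \<in> verts (graph_ball G r v)"
  then have dist: "\<mu> (\<lambda>_. 1) v u \<le> ereal (real r)"
    by (simp add: graph_ball_def graph_dist_def)
  have cost: "awalk_cost (\<lambda>_. 1) p = real (length p)" for p
    by (induction p) simp_all
  have "\<exists>p. awalk v p u \<and> length p \<le> r"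
  proof (rule ccontr)
    assume "\<not> ?thesis"
    \<comment> \<open>Lengths are integers, so otherwise the infimum is at least
      \<open>Suc r\<close>; it is infinite if there is no walk.\<close>
    then have "ereal (real (Suc r)) \<le> \<mu> (\<lambda>_. 1) v u"
      unfolding \<mu>_def cost by (intro INF_greatest) (auto simp: not_le Suc_le_eq)
    from order_trans[OF this dist] show False by simp
  qed
  then obtain p where "awalk v p u" "length p \<le> r" by blast
  then show "u \<in> vertex_ball (adjacency_matrix G) r v"
    using walk vertex_ball_mono by blast
qed

theorem theorem2p4:
  fixes G :: "('v::finite, 'e) pre_digraph"
    and \<Delta> B lambda2 :: real and r n :: nat
  assumes "graph G" and "verts G = UNIV" and "Digraph_Component.connected G"
    and "n = card (verts G)"
    and "lambda2 = second_eigenvalue G" and "lambda2 \<ge> 1"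
    and "\<Delta> \<ge> real (max_degree G)"
    and "r \<ge> 1" and "B \<ge> 1"
    and "\<And>v. v \<in> verts G \<Longrightarrow> real (out_degree G v) > lambda2 - 1 \<Longrightarrow>
           real (card (verts (graph_ball G r v))) \<ge> B"
    and "2 ^ 9 * real r * lambda2 ^ (4 * r + 2) * log 2 B \<le> log \<Delta> (real n)"
  shows "ereal (real (graph_multiplicity G lambda2)) \<le> ereal (real n) / ereal (B - 1)"
proof -
  let ?A = "adjacency_matrix G" and ?m = "graph_multiplicity G lambda2"
  have n: "n = CARD('v)" "1 \<le> n" using assms(2,4) by (simp_all add: Suc_le_eq)
  have "?m \<le> n"
    using dim_subset_UNIV[of "eigenspace ?A lambda2"]
    by (simp add: graph_multiplicity_def eigenvalue_multiplicity_def n)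
  note sym = adjacency_matrix_symmetric[OF assms(1)]
  have ball: "B \<le> real (card (vertex_ball ?A r v))" if "lambda2 - 1 < (\<Sum>u\<in>UNIV. ?A$v$u)" for v
  proof -
    have "B \<le> real (card (verts (graph_ball G r v)))"
      using assms(2,10) that by (simp add: row_sum_adjacency_matrix[OF assms(1)])
    also have "\<dots> \<le> real (card (vertex_ball ?A r v))"
      using graph_ball_subset_vertex_ball[OF assms(1)] by (intro of_nat_mono card_mono) auto
    finally show ?thesis .
  qed
  have deg: "card {u. ?A$v$u = 1} \<le> max_degree G" for v
    unfolding max_degree_def assms(2) out_degree_eq_card[OF assms(1), symmetric] by simp
  \<comment> \<open>For \<open>B = 1\<close> the quotient in \<open>ereal\<close> is infinite
    because \<open>n \<ge> 1\<close>, and for \<open>B \<le> 2\<close> it is at least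
    \<open>n\<close>. The case \<open>?m = 0\<close> also absorbs the one-vertex graph, whose second
    eigenvalue is unspecified.\<close>
  consider "B = 1" | "1 < B" "B \<le> 2" | "2 < B" "?m = 0" | "2 < B" "?m \<noteq> 0"
    using assms(9) by linarith
  then show ?thesis
  proof cases
    case 1
    then show ?thesis using n(2) by (simp add: divide_ereal_def)
  next
    case 2
    have "real ?m \<le> real n / 1" using \<open>?m \<le> n\<close> by simp
    also have "\<dots> \<le> real n / (B - 1)" using 2 by (intro divide_left_mono) auto
    finally show ?thesis using 2 by simp
  next
    case 3
    then show ?thesis by simp
  next
    case 4
    have "\<exists>v. lambda2 - 1 < (\<Sum>u\<in>UNIV. ?A$v$u)"
      using 4 by (intro eigenvalue_exceeds_degree_bound[OF sym])
        (auto simp: adjacency_matrix_nth graph_multiplicity_def)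
    then obtain v where v: "lambda2 - 1 < (\<Sum>u\<in>UNIV. ?A$v$u)" by blast
    \<comment> \<open>Some vertex has degree above \<open>lambda2 - 1\<close>, so its ball has more
      than two vertices; this also gives \<open>\<Delta> \<ge> 2\<close>, so the base of the
      logarithm is sound.\<close>
    have "2 \<le> max_degree G"
    proof (rule ccontr)
      assume "\<not> ?thesis"
      then have "card {u. ?A$v$u = 1} \<le> 1" for v using deg[of v] by linarith
      then have "card (vertex_ball ?A r v) \<le> 2" by (rule card_vertex_ball_le_2[OF sym])
      then show False using ball[OF v] 4 by linarith
    qed
    from parameter_choice[OF n(2) this assms(7) 4(1) assms(6,8,11)]
    obtain t where "1 \<le> t" and t: "real n / B
      + real ((1 + max_degree G) ^ (2 * (2 * r * t + 2 * r) + 1))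
      + real n * (1 - 1 / (2 * lambda2 ^ (4 * r + 1))) ^ t \<le> real n / (B - 1)" by blast
    have "eigenvalue_list ?A ! 1 \<le> lambda2" using assms(5) by (simp add: second_eigenvalue_def)
    from eigenvalue_multiplicity_bound[OF sym adjacency_matrix_01 deg assms(6) this _ ball assms(8) \<open>1 \<le> t\<close>] t
    have "real ?m \<le> real n / (B - 1)" using 4 by (simp add: graph_multiplicity_def n)
    then show ?thesis using 4 by simp
  qed
qed

end
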